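(* Let $K$ be a field and let $I$ be a nonzero proper graded ideal in $S=K[x_1,\ldots,x_n]$. Let $\mathrm{in}_{<_{\mathrm{lex}}}(I)$ be the initial ideal of $I$ with respect to the lexicographic order, let $L$ be the lex ideal in $S$ with the same Hilbert function as $\mathrm{in}_{<_{\mathrm{lex}}}(I)$, and let $u_1,\ldots,u_s$ be the minimal monomial generators of $L$. Let $m=\max\{\mathrm{m}(u_i)+\deg(u_i)-1\mid 1\leq i\leq s\}$ and $L^\sigma=(u_1^\sigma,\ldots,u_s^\sigma)\subset S'=K[x_1,\ldots,x_m]$. Let $d$ be the least degree of a generator of $L^\sigma$, and for $d\le i\le m$ let $a_i$ be the number of squarefree monomials of degree $i$ in $L^\sigma$ (with $a_{m+1}:=0$). Consider the following procedure. Start with $j:=\min\{\lfloor a_{d+1}/a_d\rfloor,\,m-d\}$. For the current $j$, put $p=d+j$ and compute from $g(t)=a_dt^d+\cdots+a_pt^p$ the numbers $b_d,\ldots,b_p$ determined recursively by: $g_0:=g$, and for $i=d,\ldots,p$, $b_i$ is the coefficient of $t^i$ in $g_{i-d}(t)$ and $g_{i-d+1}(t):=g_{i-d}(t)-b_it^i(1+t)^{p-i}$. If $b_d,\ldots,b_p\in\mathbb{Z}_{\geq 0}$, stop with value $h:=d+j$; otherwise replace $j$ by $j-1$ and repeat. Then the procedure stops after finitely many steps, $h=\mathrm{hdepth}(L^\sigma)$ (as an ideal of $S'$), and $$\mathrm{hdepth}(I)=\mathrm{hdepth}(L)=\mathrm{hdepth}(L^\sigma)-(m-n).$$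
   Context: Polynomial rings are $\mathbb{Z}$-graded with $\deg(x_i)=1$; $H_I(t)=\sum_k\dim_K(I_k)t^k$ is the Hilbert series of a graded ideal $I$. A Hilbert decomposition of a graded ideal $I$ of $K[x_1,\ldots,x_n]$ is an isomorphism of graded $K$-vector spaces $\mathcal{H}: I\cong\bigoplus_{i=1}^r K[Z_i](-s_i)$ with $s_i\in\mathbb{Z}_{\geq 0}$ and $Z_i\subset\{x_1,\ldots,x_n\}$. Its Hilbert depth is $\mathrm{hdepth}(\mathcal{H})=\min_i|Z_i|$, and $\mathrm{hdepth}(I)$ is the maximum of $\mathrm{hdepth}(\mathcal{H})$ over all Hilbert decompositions $\mathcal{H}$ of $I$. A lex ideal is a monomial ideal $L$ such that whenever $u\in L$ is a monomial and $v$ is a monomial of the same degree with $v>_{\mathrm{lex}}u$ (with $x_1>x_2>\cdots>x_n$), then $v\in L$. By Macaulay's theorem, for every graded ideal there is a unique lex ideal in $S$ with the same Hilbert function. Squarefree operator: for a monomial $u=x_{i_1}x_{i_2}\cdots x_{i_e}$ with $i_1\leq i_2\leq\cdots\leq i_e$, put $\mathrm{m}(u):=i_e$ and $u^\sigma:=x_{i_1}x_{i_2+1}\cdots x_{i_e+e-1}$. *)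

theory Defs
  imports
    "HOL-Library.Poly_Mapping"
    "HOL-Library.While_Combinator"
    "HOL-Algebra.Ideal"
    "HOL-Computational_Algebra.Polynomial"
begin

text \<open>
  The variables are indexed by natural numbers, so that polynomial rings in different numbers of
  variables live in one type; \<open>polys Z\<close> is \<open>K[x\<^sub>i | i \<in> Z]\<close> and \<open>K[x\<^sub>1,\<dots>,x\<^sub>n]\<close> is \<open>polys {1..n}\<close>.
\<close>

type_synonym mon = "nat \<Rightarrow>\<^sub>0 nat"
type_synonym 'k mpol = "mon \<Rightarrow>\<^sub>0 'k"

definition mdeg :: "mon \<Rightarrow> nat" where
  "mdeg u = (\<Sum>i\<in>Poly_Mapping.keys u. Poly_Mapping.lookup u i)"

definition mons :: "nat set \<Rightarrow> mon set" where
  "mons Z = {u. Poly_Mapping.keys u \<subseteq> Z}"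

abbreviation mono_pol :: "mon \<Rightarrow> 'k::field mpol" where
  "mono_pol u \<equiv> Poly_Mapping.single u 1"

definition polys :: "nat set \<Rightarrow> 'k::field mpol set" where
  "polys Z = {f. Poly_Mapping.keys f \<subseteq> mons Z}"

definition PR :: "nat \<Rightarrow> 'k::field mpol ring" where
  "PR n = \<lparr>carrier = polys {1..n}, monoid.mult = (*), one = 1, zero = 0, add = (+)\<rparr>"

definition cscale :: "'k::field \<Rightarrow> 'k mpol \<Rightarrow> 'k mpol" where
  "cscale c f = Poly_Mapping.single 0 c * f"

interpretation mpol_vs: vector_space cscale
  by unfold_locales
    (simp_all add: cscale_def algebra_simps Poly_Mapping.single_add Poly_Mapping.mult_single
      flip: mult.assoc)

lemma polys_add: "f \<in> polys Z \<Longrightarrow> g \<in> polys Z \<Longrightarrow> f + g \<in> polys Z"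
  unfolding polys_def using Poly_Mapping.keys_add[of f g] by blast

lemma polys_mult:
  assumes "f \<in> polys Z" "g \<in> polys Z" shows "f * g \<in> polys Z"
proof -
  have "u + v \<in> mons Z" if "u \<in> mons Z" "v \<in> mons Z" for u v
    using that Poly_Mapping.keys_add[of u v] unfolding mons_def by blast
  thus ?thesis using assms Poly_Mapping.keys_mult[of f g] unfolding polys_def by blast
qed

lemma cring_PR: "cring (PR n :: 'k::field mpol ring)"
proof (rule cringI)
  show "abelian_group (PR n :: 'k mpol ring)"
  proof (rule abelian_groupI)
    fix f :: "'k mpol" assume "f \<in> carrier (PR n)"
    hence "- f \<in> carrier (PR n)" by (simp add: PR_def polys_def)
    thus "\<exists>g\<in>carrier (PR n). g \<oplus>\<^bsub>PR n\<^esub> f = \<zero>\<^bsub>PR n\<^esub>"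
      by (intro bexI[of _ "- f"]) (auto simp: PR_def)
  qed (auto simp: PR_def polys_add algebra_simps, simp add: polys_def)
  show "comm_monoid (PR n :: 'k mpol ring)"
    by (rule comm_monoidI) (auto simp: PR_def polys_mult algebra_simps, simp add: polys_def mons_def)
qed (auto simp: PR_def algebra_simps)


subsection \<open>Graded ideals, Hilbert functions\<close>

definition homog :: "nat \<Rightarrow> 'k::field mpol \<Rightarrow> bool" where
  "homog k f \<longleftrightarrow> (\<forall>u\<in>Poly_Mapping.keys f. mdeg u = k)"

definition hcomp :: "nat \<Rightarrow> 'k::field mpol \<Rightarrow> 'k mpol" where
  "hcomp k f = (\<Sum>u\<in>{u\<in>Poly_Mapping.keys f. mdeg u = k}.
     Poly_Mapping.single u (Poly_Mapping.lookup f u))"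

definition graded_ideal :: "nat \<Rightarrow> 'k::field mpol set \<Rightarrow> bool" where
  "graded_ideal n I \<longleftrightarrow> ideal I (PR n) \<and> (\<forall>f\<in>I. \<forall>k. hcomp k f \<in> I)"

definition hilbert_fun :: "'k::field mpol set \<Rightarrow> nat \<Rightarrow> nat" where
  "hilbert_fun I k = mpol_vs.dim {f \<in> I. homog k f}"


subsection \<open>Hilbert decompositions and Hilbert depth\<close>

text \<open>
  A list \<open>[(Z\<^sub>1,s\<^sub>1),\<dots>,(Z\<^sub>r,s\<^sub>r)]\<close> stands for \<open>\<Oplus>\<^sub>i K[Z\<^sub>i](-s\<^sub>i)\<close>, whose elements are families indexed by
  \<open>{..<r}\<close>, extended by \<open>0\<close>. In degree \<open>k\<close> the summand \<open>K[Z\<^sub>i](-s\<^sub>i)\<close> is \<open>K[Z\<^sub>i]\<close> in degree \<open>k - s\<^sub>i\<close>,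
  hence \<open>0\<close> for \<open>k < s\<^sub>i\<close>.
\<close>

definition dsum :: "(nat set \<times> nat) list \<Rightarrow> (nat \<Rightarrow> 'k::field mpol) set" where
  "dsum D = {w. (\<forall>i<length D. w i \<in> polys (fst (D ! i))) \<and> (\<forall>i\<ge>length D. w i = 0)}"

definition dsum_comp :: "(nat set \<times> nat) list \<Rightarrow> nat \<Rightarrow> (nat \<Rightarrow> 'k::field mpol) set" where
  "dsum_comp D k = {w \<in> dsum D. \<forall>i<length D. \<forall>u\<in>Poly_Mapping.keys (w i). mdeg u + snd (D ! i) = k}"

definition graded_iso ::
  "'k::field mpol set \<Rightarrow> (nat set \<times> nat) list \<Rightarrow> ('k mpol \<Rightarrow> nat \<Rightarrow> 'k mpol) \<Rightarrow> bool" where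
  "graded_iso I D \<phi> \<longleftrightarrow>
     bij_betw \<phi> I (dsum D) \<and>
     (\<forall>f\<in>I. \<forall>g\<in>I. \<phi> (f + g) = (\<lambda>i. \<phi> f i + \<phi> g i)) \<and>
     (\<forall>c. \<forall>f\<in>I. \<phi> (cscale c f) = (\<lambda>i. cscale c (\<phi> f i))) \<and>
     (\<forall>k. \<phi> ` {f \<in> I. homog k f} = dsum_comp D k)"

definition hilbert_decomp :: "nat \<Rightarrow> 'k::field mpol set \<Rightarrow> (nat set \<times> nat) list \<Rightarrow> bool" where
  "hilbert_decomp n I D \<longleftrightarrow> (\<forall>(Z, s)\<in>set D. Z \<subseteq> {1..n}) \<and> (\<exists>\<phi>. graded_iso I D \<phi>)"

definition decomp_hdepth :: "(nat set \<times> nat) list \<Rightarrow> nat" where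
  "decomp_hdepth D = Min ((\<lambda>(Z, s). card Z) ` set D)"

definition hdepth :: "nat \<Rightarrow> 'k::field mpol set \<Rightarrow> nat" where
  "hdepth n I = Max {decomp_hdepth D | D. hilbert_decomp n I D}"


subsection \<open>Initial ideals and lex ideals\<close>

text \<open>
  The order \<open><\<close> of \<^theory>\<open>HOL-Library.Poly_Mapping\<close> on exponent vectors compares at the smallest
  index where they differ, so it is the lexicographic order with \<open>x\<^sub>1 > x\<^sub>2 > \<dots>\<close>.
\<close>

definition lex_lead :: "'k::field mpol \<Rightarrow> mon" where
  "lex_lead f = Max (Poly_Mapping.keys f)"

definition lex_initial_ideal :: "nat \<Rightarrow> 'k::field mpol set \<Rightarrow> 'k mpol set" where
  "lex_initial_ideal n I = Idl\<^bsub>PR n\<^esub> {mono_pol (lex_lead f) | f. f \<in> I \<and> f \<noteq> 0}"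

definition mon_gen :: "nat \<Rightarrow> mon set \<Rightarrow> 'k::field mpol set" where
  "mon_gen n M = Idl\<^bsub>PR n\<^esub> (mono_pol ` M)"

definition monomial_ideal :: "nat \<Rightarrow> 'k::field mpol set \<Rightarrow> bool" where
  "monomial_ideal n L \<longleftrightarrow> (\<exists>M \<subseteq> mons {1..n}. L = mon_gen n M)"

definition lex_ideal :: "nat \<Rightarrow> 'k::field mpol set \<Rightarrow> bool" where
  "lex_ideal n L \<longleftrightarrow> monomial_ideal n L \<and>
     (\<forall>u\<in>mons {1..n}. \<forall>v\<in>mons {1..n}.
        mono_pol u \<in> L \<longrightarrow> mdeg v = mdeg u \<longrightarrow> v > u \<longrightarrow> mono_pol v \<in> L)"

definition min_mon_gens :: "nat \<Rightarrow> 'k::field mpol set \<Rightarrow> mon set \<Rightarrow> bool" where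
  "min_mon_gens n L G \<longleftrightarrow>
     G \<subseteq> mons {1..n} \<and> L = mon_gen n G \<and> (\<forall>H. H \<subset> G \<longrightarrow> L \<noteq> mon_gen n H)"


subsection \<open>The squarefree operator\<close>

text \<open>The list \<open>[i\<^sub>1,\<dots>,i\<^sub>e]\<close> with \<open>u = x\<^bsub>i\<^sub>1\<^esub> \<cdots> x\<^bsub>i\<^sub>e\<^esub>\<close> and \<open>i\<^sub>1 \<le> \<dots> \<le> i\<^sub>e\<close>.\<close>

definition var_list :: "mon \<Rightarrow> nat list" where
  "var_list u =
     concat (map (\<lambda>i. replicate (Poly_Mapping.lookup u i) i) (sorted_list_of_set (Poly_Mapping.keys u)))"

definition max_var :: "mon \<Rightarrow> nat" where
  "max_var u = last (var_list u)"

text \<open>Lists are indexed from \<open>0\<close>, so the shift by \<open>k - 1\<close> of the \<open>k\<close>-th index becomes a shift by \<open>k\<close>.\<close>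

definition sq_op :: "mon \<Rightarrow> mon" where
  "sq_op u = (\<Sum>k<length (var_list u). Poly_Mapping.single (var_list u ! k + k) 1)"

definition sqfree_mon :: "mon \<Rightarrow> bool" where
  "sqfree_mon u \<longleftrightarrow> (\<forall>i. Poly_Mapping.lookup u i \<le> 1)"

definition sqfree_count :: "nat \<Rightarrow> 'k::field mpol set \<Rightarrow> nat \<Rightarrow> nat" where
  "sqfree_count m J i = card {v \<in> mons {1..m}. sqfree_mon v \<and> mdeg v = i \<and> mono_pol v \<in> J}"


subsection \<open>The procedure\<close>

text \<open>\<open>g_seq a d p k\<close> is \<open>g\<^sub>k\<close>, and \<open>b_coeff a d p i\<close> is \<open>b\<^sub>i\<close>.\<close>

primrec g_seq :: "(nat \<Rightarrow> nat) \<Rightarrow> nat \<Rightarrow> nat \<Rightarrow> nat \<Rightarrow> int poly" where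
  "g_seq a d p 0 = (\<Sum>i=d..p. monom (int (a i)) i)"
| "g_seq a d p (Suc k) =
     g_seq a d p k - monom (coeff (g_seq a d p k) (d + k)) (d + k) * [:1, 1:] ^ (p - (d + k))"

definition b_coeff :: "(nat \<Rightarrow> nat) \<Rightarrow> nat \<Rightarrow> nat \<Rightarrow> nat \<Rightarrow> int" where
  "b_coeff a d p i = coeff (g_seq a d p (i - d)) i"

text \<open>
  The result is \<open>None\<close> if the procedure does not terminate. Here \<open>j\<close> is a natural number, so a
  failure at \<open>j = 0\<close> would make the loop run forever.
\<close>

definition hdepth_procedure :: "(nat \<Rightarrow> nat) \<Rightarrow> nat \<Rightarrow> nat \<Rightarrow> nat option" where
  "hdepth_procedure a d m =
     map_option (\<lambda>j. d + j)
       (while_option (\<lambda>j. \<not> (\<forall>i\<in>{d..d + j}. b_coeff a d (d + j) i \<ge> 0)) (\<lambda>j. j - 1)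
         (min (a (d + 1) div a d) (m - d)))"

end

theory Submission
  imports Defs "HOL-Computational_Algebra.Polynomial_FPS" "HOL-Library.Multiset"
begin

text \<open>
  By Uliczka's criterion the Hilbert depth of a graded ideal depends only on its Hilbert series
  \<open>H\<close>: it is the largest \<open>r\<close> not exceeding the number of variables for which \<open>(1 - t)\<^sup>r H(t)\<close> has
  nonnegative coefficients. Passing to the initial ideal, and then to \<open>L\<close>, preserves \<open>H\<close>.

  A monomial of \<open>L\<close>, written as a weakly increasing word, has exactly one generator as a prefix;
  likewise the support of a monomial of \<open>L\<^sup>\<sigma>\<close>, written as a strictly increasing word, has exactly
  one \<open>u\<^sup>\<sigma>\<close> as a prefix. The resulting Stanley decompositions of \<open>L\<close> and \<open>L\<^sup>\<sigma>\<close> show that the two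
  Hilbert series differ by the factor \<open>(1 - t)\<^sup>m\<^sup>-\<^sup>n\<close>. Moreover the Hilbert series of \<open>L\<^sup>\<sigma>\<close> is obtained
  from \<open>\<Sum> a\<^sub>i t\<^sup>i\<close> by substituting \<open>t/(1 - t)\<close> for \<open>t\<close>; this turns the expansion in the
  \<open>t\<^sup>i (1 + t)\<^sup>p\<^sup>-\<^sup>i\<close> computed by the procedure into the coefficients of \<open>(1 - t)\<^sup>p H(t)\<close> up to degree \<open>p\<close>,
  the later ones being nonnegative anyway.
\<close>

text \<open>A graded isomorphism is a matter of dimensions only, so a Hilbert decomposition amounts
  to writing the Hilbert series as a sum of terms t^s/(1-t)^c with c at most the number of
  variables. The hard half of the criterion is to find such a sum when (1-t)^r H is merely
  nonnegative. It rests on rationality: if the only pole is at 1, the coefficients are eventually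
  monotone, so after finitely many terms a factor 1/(1-t) splits off and the pole order drops. The
  shift m - n is the same for every generator g: its cell in L has n + 1 - m(g) free variables, its
  cell in L\<sigma> has the deg g variables of the support and m - (m(g) + deg g - 1) later ones,
  together m + 1 - m(g). Since m may be smaller than n, the two series are compared with powers of
  1/(1-t) on both sides. The starting value of the procedure comes from b_(d+1) = a_(d+1) - (p - d)
  a_d, whose nonnegativity bounds j by the quotient; at j = 0 only b_d = a_d remains, so the descent
  ends.\<close>

unbundle fps_syntax

subsection \<open>Nonnegative integer power series\<close>

text \<open>The series 1/(1-t); \<open>geom ^ c\<close> is the Hilbert series of a polynomial ring
  in c variables.\<close>

definition geom :: "int fps" where
  "geom = Abs_fps (\<lambda>_. 1)"

lemma one_minus_X_mult_nth:
  "((1 - fps_X) * F) $ k = F $ k - (if k = 0 then 0 else F $ (k - 1))" for F :: "int fps"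
  by (simp add: algebra_simps)

lemma one_minus_X_mult_nth_Suc: "((1 - fps_X) * F) $ Suc k = F $ Suc k - F $ k" for F :: "int fps"
  by (simp add: one_minus_X_mult_nth)

lemma one_minus_X_geom: "(1 - fps_X) * geom = 1"
  by (rule fps_ext) (simp add: one_minus_X_mult_nth geom_def)

lemma one_minus_X_power_geom: "(1 - fps_X) ^ k * geom ^ k = 1"
  by (simp add: one_minus_X_geom flip: power_mult_distrib)

lemma one_plus_X_power_nth: "((1 + fps_X) ^ N :: int fps) $ k = int (N choose k)"
proof (induction N arbitrary: k)
  case 0
  then show ?case by (cases k) auto
next
  case (Suc N)
  then show ?case by (cases k) (auto simp: distrib_right)
qed

definition nonneg_fps :: "int fps \<Rightarrow> bool" where
  "nonneg_fps F \<longleftrightarrow> (\<forall>k. F $ k \<ge> 0)"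

lemma nonneg_fps_sum: "(\<And>x. x \<in> A \<Longrightarrow> nonneg_fps (f x)) \<Longrightarrow> nonneg_fps (sum f A)"
  by (simp add: nonneg_fps_def fps_sum_nth sum_nonneg)

lemma nonneg_fps_mult: "nonneg_fps F \<Longrightarrow> nonneg_fps H \<Longrightarrow> nonneg_fps (F * H)"
  by (auto simp: nonneg_fps_def fps_mult_nth intro!: sum_nonneg)

lemma nonneg_fps_power: "nonneg_fps F \<Longrightarrow> nonneg_fps (F ^ k)"
  by (induction k) (auto simp: nonneg_fps_mult, simp add: nonneg_fps_def)

lemma nonneg_fps_geom: "nonneg_fps geom"
  by (simp add: nonneg_fps_def geom_def)

lemma nonneg_fps_X: "nonneg_fps fps_X"
  by (simp add: nonneg_fps_def fps_X_def)

text \<open>An integer sequence that is eventually monotone is eventually of one sign, so the sign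
  pattern propagates from a difference sequence to the sequence itself.\<close>

lemma eventually_sign_if_difference:
  fixes f :: "nat \<Rightarrow> int"
  assumes "(\<forall>k\<ge>N. f (Suc k) - f k \<ge> 0) \<or> (\<forall>k\<ge>N. f (Suc k) - f k < 0)"
  shows "\<exists>M. (\<forall>k\<ge>M. f k \<ge> 0) \<or> (\<forall>k\<ge>M. f k < 0)"
  using assms
proof
  assume inc: "\<forall>k\<ge>N. f (Suc k) - f k \<ge> 0"
  show ?thesis
  proof (cases "\<exists>M\<ge>N. f M \<ge> 0")
    case True
    then obtain M where M: "M \<ge> N" "f M \<ge> 0" by blast
    have "f k \<ge> 0" if "k \<ge> M" for k
      using that
    proof (induction k rule: dec_induct)
      case (step k)
      then show ?case using inc[rule_format, of k] M by simp
    qed (use M in simp)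
    then show ?thesis by blast
  next
    case False
    then show ?thesis by (meson linorder_not_le)
  qed
next
  assume dec: "\<forall>k\<ge>N. f (Suc k) - f k < 0"
  have bound: "f k \<le> f N - int (k - N)" if "k \<ge> N" for k
    using that
  proof (induction k rule: dec_induct)
    case (step k)
    then show ?case using dec[rule_format, of k] by (simp add: Suc_diff_le)
  qed simp
  have "f k < 0" if "k \<ge> N + nat \<bar>f N\<bar> + 1" for k
    using bound[of k] that by linarith
  then show ?thesis by blast
qed

text \<open>Induction on the pole order at 1: multiplication by \<open>1 - fps_X\<close> passes to
  the difference sequence and lowers the order, and the coefficients of a polynomial are eventually
  0.\<close>

lemma eventually_sign_of_rational_fps:
  fixes F :: "int fps"
  assumes "(1 - fps_X) ^ e * F = fps_of_poly q"
  shows "\<exists>N. (\<forall>k\<ge>N. F $ k \<ge> 0) \<or> (\<forall>k\<ge>N. F $ k < 0)"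
  using assms
proof (induction e arbitrary: F)
  case 0
  then have "\<forall>k\<ge>Suc (degree q). F $ k \<ge> 0" by (simp add: coeff_eq_0)
  then show ?case by blast
next
  case (Suc e)
  then have "(1 - fps_X) ^ e * ((1 - fps_X) * F) = fps_of_poly q" by (simp add: mult_ac)
  from Suc.IH[OF this] obtain N where
    "(\<forall>k\<ge>N. ((1 - fps_X) * F) $ k \<ge> 0) \<or> (\<forall>k\<ge>N. ((1 - fps_X) * F) $ k < 0)" by blast
  then have "(\<forall>k\<ge>N. F $ Suc k - F $ k \<ge> 0) \<or> (\<forall>k\<ge>N. F $ Suc k - F $ k < 0)"
    by (metis one_minus_X_mult_nth_Suc le_SucI)
  then show ?case by (rule eventually_sign_if_difference)
qed

text \<open>A pair (c, s) encodes a polynomial ring in c variables shifted by s. The coefficient at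
  N becomes that many copies of (0, N).\<close>

lemma nonneg_cutoff_decomp:
  fixes F :: "int fps"
  assumes "nonneg_fps F"
  shows "\<exists>l. (\<forall>(c, s)\<in>set l. c = 0) \<and> fps_cutoff N F = (\<Sum>(c, s)\<leftarrow>l. fps_X ^ s * geom ^ c)"
proof (induction N)
  case 0
  then show ?case by (intro exI[of _ "[]"]) simp
next
  case (Suc N)
  then obtain l where l: "\<forall>(c, s)\<in>set l. c = 0"
    "fps_cutoff N F = (\<Sum>(c, s)\<leftarrow>l. fps_X ^ s * geom ^ c)" by blast
  have "(\<Sum>(c, s)\<leftarrow>replicate k (0, N). fps_X ^ s * geom ^ c) = fps_const (int k) * fps_X ^ N" for k
    by (induction k) (simp_all add: algebra_simps flip: fps_const_add)
  moreover have "fps_cutoff (Suc N) F = fps_cutoff N F + fps_const (F $ N) * fps_X ^ N"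
    by (rule fps_ext) (auto simp: less_Suc_eq)
  moreover have "int (nat (F $ N)) = F $ N"
    using assms by (simp add: nonneg_fps_def)
  ultimately have "fps_cutoff (Suc N) F
      = (\<Sum>(c, s)\<leftarrow>l @ replicate (nat (F $ N)) (0, N). fps_X ^ s * geom ^ c)"
    using l(2) by (simp del: sum_list_replicate map_replicate)
  moreover have "\<forall>(c, s)\<in>set (l @ replicate (nat (F $ N)) (0, N)). c = 0"
    using l(1) by auto
  ultimately show ?case by blast
qed

text \<open>Split off the initial part of the series up to an index from which on
  the coefficients do not decrease; the remainder is \<open>geom\<close> times a nonnegative series with
  smaller pole order at \<open>1\<close>.\<close>

lemma nonneg_rational_fps_decomp:
  fixes F :: "int fps"
  assumes "nonneg_fps F" "(1 - fps_X) ^ e * F = fps_of_poly q"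
  shows "\<exists>l. (\<forall>(c, s)\<in>set l. c \<le> e) \<and> F = (\<Sum>(c, s)\<leftarrow>l. fps_X ^ s * geom ^ c)"
  using assms
proof (induction e arbitrary: F q)
  case 0
  have "F = fps_cutoff (Suc (degree q)) F"
    using 0(2) by (intro fps_ext) (simp add: coeff_eq_0)
  then show ?case using nonneg_cutoff_decomp[OF 0(1), of "Suc (degree q)"] by auto
next
  case (Suc e)
  have "(1 - fps_X) ^ e * ((1 - fps_X) * F) = fps_of_poly q"
    using Suc.prems(2) by (simp add: mult_ac)
  then obtain N where N:
    "(\<forall>k\<ge>N. ((1 - fps_X) * F) $ k \<ge> 0) \<or> (\<forall>k\<ge>N. ((1 - fps_X) * F) $ k < 0)"
    using eventually_sign_of_rational_fps by blast
  \<comment> \<open>An integer sequence that strictly decreases from N on would become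
    negative.\<close>
  have "\<not> (\<forall>k\<ge>N. ((1 - fps_X) * F) $ k < 0)"
  proof
    assume "\<forall>k\<ge>N. ((1 - fps_X) * F) $ k < 0"
    then have dec: "F $ Suc k < F $ k" if "k \<ge> N" for k
      using that by (metis one_minus_X_mult_nth_Suc diff_less_0_iff_less le_SucI)
    have "F $ (N + k) \<le> F $ N - int k" for k
    proof (induction k)
      case (Suc k)
      then show ?case using dec[of "N + k"] by simp
    qed simp
    from this[of "nat (F $ N) + 1"] Suc.prems(1) show False
      unfolding nonneg_fps_def by (smt (verit) int_nat_eq of_nat_1 of_nat_add)
  qed
  with N have inc: "\<forall>k\<ge>N. ((1 - fps_X) * F) $ k \<ge> 0" by blast
  define T where "T = fps_cutoff N F"
  define F' where "F' = (1 - fps_X) * (F - T)"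
  \<comment> \<open>Below N everything cancels; at N the predecessor has been cut off, so the
    coefficient is \<open>F $ N\<close> itself; beyond N it is a difference covered by
    \<open>inc\<close>.\<close>
  have "nonneg_fps F'"
    unfolding nonneg_fps_def
  proof
    fix k
    consider "k < N" | "k = N" | "k > N" by linarith
    then show "F' $ k \<ge> 0"
    proof cases
      case 3
      then show ?thesis using inc[rule_format, of k]
        by (auto simp: F'_def T_def one_minus_X_mult_nth split: if_splits)
    qed (use Suc.prems(1) in \<open>auto simp: F'_def T_def one_minus_X_mult_nth nonneg_fps_def\<close>)
  qed
  \<comment> \<open>The cut-off part is a polynomial, so removing it changes only the
    numerator.\<close>
  moreover have "(1 - fps_X) ^ e * F' = fps_of_poly (q - [:1, -1:] ^ Suc e * truncate_fps N F)"
  proof -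
    have X: "fps_of_poly [:1, -1:] = (1 - fps_X :: int fps)"
      by (rule fps_ext) (auto simp: coeff_pCons split: nat.splits)
    have "(1 - fps_X) ^ e * F' = (1 - fps_X) ^ Suc e * F - (1 - fps_X) ^ Suc e * T"
      by (simp add: F'_def algebra_simps)
    then show ?thesis
      unfolding Suc.prems(2) by (simp add: T_def X fps_of_poly_diff fps_of_poly_mult fps_of_poly_power del: power_Suc)
  qed
  ultimately obtain l where l: "\<forall>(c, s)\<in>set l. c \<le> e" "F' = (\<Sum>(c, s)\<leftarrow>l. fps_X ^ s * geom ^ c)"
    using Suc.IH by blast
  obtain l0 where l0: "\<forall>(c, s)\<in>set l0. c = 0" "T = (\<Sum>(c, s)\<leftarrow>l0. fps_X ^ s * geom ^ c)"
    using nonneg_cutoff_decomp[OF Suc.prems(1)] T_def by metis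
  define l1 where "l1 = map (\<lambda>(c, s). (Suc c, s)) l"
  have "(\<Sum>(c, s)\<leftarrow>l1. fps_X ^ s * geom ^ c) = geom * F'"
    by (simp add: l1_def l(2) o_def split_beta sum_list_const_mult[symmetric] mult_ac)
  also have "\<dots> = F - T"
    using one_minus_X_geom by (simp add: F'_def mult.assoc[symmetric] mult.commute)
  finally have "F = (\<Sum>(c, s)\<leftarrow>l0 @ l1. fps_X ^ s * geom ^ c)"
    using l0(2) by simp
  moreover have "\<forall>(c, s)\<in>set (l0 @ l1). c \<le> Suc e"
    using l(1) l0(1) by (auto simp: l1_def)
  ultimately show ?case by blast
qed


section \<open>The expansion computed by the procedure\<close>

text \<open>Step k cancels the coefficient of t^(d+k) and, its subtrahend being divisible by
  t^(d+k), leaves the lower ones alone.\<close>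

lemma coeff_g_seq_low: "i < d + k \<Longrightarrow> coeff (g_seq a d p k) i = 0"
proof (induction k arbitrary: i)
  case 0
  then show ?case by (simp add: coeff_sum)
next
  case (Suc k)
  show ?case
  proof (cases "i = d + k")
    case True
    then show ?thesis by (simp add: coeff_monom_mult coeff_0_power)
  next
    case False
    with Suc.prems have "i < d + k" by simp
    with Suc.IH[OF this] show ?thesis by (simp add: coeff_monom_mult)
  qed
qed

text \<open>Every t^i (1+t)^(p-i) has degree p. The bound on k keeps the subtraction in the exponent
  from truncating.\<close>

lemma coeff_g_seq_high: "p < i \<Longrightarrow> d + k \<le> Suc p \<Longrightarrow> coeff (g_seq a d p k) i = 0"
proof (induction k)
  case 0
  then show ?case by (simp add: coeff_sum)
next
  case (Suc k)
  have "degree ([:1, 1::int:] ^ (p - (d + k))) \<le> p - (d + k)"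
    using degree_power_le[of "[:1, 1::int:]" "p - (d + k)"] by simp
  with Suc show ?case by (simp add: coeff_monom_mult coeff_eq_0)
qed

lemma g_seq_eq_diff:
  "g_seq a d p k = (\<Sum>i=d..p. monom (int (a i)) i)
     - (\<Sum>i=d..<d + k. monom (b_coeff a d p i) i * [:1, 1:] ^ (p - i))"
  by (induction k) (simp_all add: b_coeff_def)

text \<open>After p - d + 1 steps all coefficients up to p are cleared and none above p has
  appeared, so the remainder is 0.\<close>

lemma b_coeff_expansion:
  assumes "d \<le> p"
  shows "(\<Sum>i=d..p. monom (int (a i)) i) = (\<Sum>i=d..p. monom (b_coeff a d p i) i * [:1, 1:] ^ (p - i))"
proof -
  have "g_seq a d p (Suc p - d) = 0"
    using assms coeff_g_seq_low[of _ d "Suc p - d" a p] coeff_g_seq_high[of p _ d "Suc p - d" a]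
    by (intro poly_eqI) (metis coeff_0 le_add_diff_inverse le_SucI not_less_eq order_refl)
  then show ?thesis
    using assms g_seq_eq_diff[of a d p "Suc p - d"] by (simp add: atLeastLessThanSuc_atLeastAtMost)
qed

lemma fps_monom_compose_geom: "(fps_const c * fps_X ^ k) oo (fps_X * geom) = fps_const c * (fps_X ^ k * geom ^ k)"
  by (simp add: fps_compose_mult_distrib power_mult_distrib flip: fps_compose_power)

lemma one_plus_X_compose_geom: "(1 + fps_X) oo (fps_X * geom) = geom"
  using one_minus_X_geom by (simp add: fps_compose_add_distrib algebra_simps)

text \<open>Substituting \<open>t/(1 - t)\<close> for \<open>t\<close> turns \<open>1 + t\<close> into \<open>1/(1 - t)\<close>, so the expansion of \<open>g\<close> in
  the \<open>t\<^sup>i (1 + t)\<^sup>p\<^sup>-\<^sup>i\<close> becomes the power series expansion of a multiple of \<open>g (t/(1 - t))\<close>.\<close>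

lemma b_coeff_series:
  assumes "d \<le> p"
  shows "(1 - fps_X) ^ p * (\<Sum>k=d..p. fps_const (int (a k)) * (fps_X ^ k * geom ^ k))
    = (\<Sum>i=d..p. fps_const (b_coeff a d p i) * fps_X ^ i)"
proof -
  have X: "fps_of_poly [:1, 1:] = (1 + fps_X :: int fps)"
    by (rule fps_ext) (auto simp: coeff_pCons fps_X_def split: nat.splits)
  have "(\<Sum>k=d..p. fps_const (int (a k)) * (fps_X ^ k * geom ^ k))
      = fps_of_poly (\<Sum>i=d..p. monom (int (a i)) i) oo (fps_X * geom)"
    by (simp add: fps_of_poly_sum fps_compose_sum_distrib fps_of_poly_monom fps_monom_compose_geom)
  also have "\<dots> = (\<Sum>i=d..p. fps_const (b_coeff a d p i) * fps_X ^ i * (geom ^ i * geom ^ (p - i)))"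
    unfolding b_coeff_expansion[OF assms]
    by (simp add: fps_of_poly_sum fps_compose_sum_distrib fps_of_poly_mult fps_of_poly_monom
        fps_of_poly_power X fps_compose_mult_distrib fps_monom_compose_geom one_plus_X_compose_geom
        mult.assoc power_mult_distrib flip: fps_compose_power)
  also have "\<dots> = (\<Sum>i=d..p. fps_const (b_coeff a d p i) * fps_X ^ i) * geom ^ p"
    by (simp add: sum_distrib_right flip: power_add)
  finally show ?thesis
    using one_minus_X_power_geom[of p] by (simp add: mult_ac)
qed

lemma nonneg_fps_const: "c \<ge> 0 \<Longrightarrow> nonneg_fps (fps_const c)"
  by (simp add: nonneg_fps_def)

lemmas nonneg_fps_intros =
  nonneg_fps_sum nonneg_fps_mult nonneg_fps_power nonneg_fps_geom nonneg_fps_X nonneg_fps_const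

text \<open>A term with k > p keeps a factor \<open>geom ^ (k - p)\<close>: it is nonnegative and
  starts beyond t^p, so it cannot compensate for a negative b_i.\<close>

lemma nonneg_iff_b_coeff_nonneg:
  assumes "d \<le> p" "p \<le> m"
    and H: "H = (\<Sum>k=d..m. fps_const (int (a k)) * (fps_X ^ k * geom ^ k))"
  shows "nonneg_fps ((1 - fps_X) ^ p * H) \<longleftrightarrow> (\<forall>i\<in>{d..p}. b_coeff a d p i \<ge> 0)"
proof -
  define B where "B = (\<Sum>i=d..p. fps_const (b_coeff a d p i) * fps_X ^ i)"
  define T where "T = (\<Sum>k=Suc p..m. fps_const (int (a k)) * (fps_X ^ k * geom ^ (k - p)))"
  have "(1 - fps_X) ^ p * geom ^ k = geom ^ (k - p)" if "k > p" for k
  proof -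
    have "geom ^ k = geom ^ p * geom ^ (k - p)"
      using that by (simp flip: power_add)
    then show ?thesis
      using one_minus_X_power_geom[of p] by (simp flip: mult.assoc)
  qed
  then have "(1 - fps_X) ^ p * (\<Sum>k=Suc p..m. fps_const (int (a k)) * (fps_X ^ k * geom ^ k)) = T"
    unfolding T_def sum_distrib_left by (intro sum.cong) (auto simp: mult_ac)
  moreover have "{d..m} = {d..p} \<union> {Suc p..m}" using assms by auto
  then have "H = (\<Sum>k=d..p. fps_const (int (a k)) * (fps_X ^ k * geom ^ k))
      + (\<Sum>k=Suc p..m. fps_const (int (a k)) * (fps_X ^ k * geom ^ k))"
    unfolding H by (simp add: sum.union_disjoint)
  ultimately have eq: "(1 - fps_X) ^ p * H = B + T"
    using b_coeff_series[OF assms(1), of a] by (simp add: B_def distrib_left)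
  have T0: "T $ i = 0" if "i \<le> p" for i
    using that by (auto simp: T_def fps_sum_nth fps_X_power_mult_nth intro!: sum.neutral)
  have T: "nonneg_fps T"
    unfolding T_def by (intro nonneg_fps_intros) simp
  have B: "B $ i = (if i \<in> {d..p} then b_coeff a d p i else 0)" for i
    by (simp add: B_def fps_sum_nth if_distrib cong: if_cong)
  show ?thesis
    unfolding eq nonneg_fps_def
  proof
    assume "\<forall>k. 0 \<le> (B + T) $ k"
    then show "\<forall>i\<in>{d..p}. b_coeff a d p i \<ge> 0"
      using B T0 by (metis add.right_neutral atLeastAtMost_iff fps_add_nth)
  next
    assume "\<forall>i\<in>{d..p}. b_coeff a d p i \<ge> 0"
    then show "\<forall>k. 0 \<le> (B + T) $ k"
      using T by (auto simp: B nonneg_fps_def)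
  qed
qed

text \<open>For p = d this is the only condition, so the procedure succeeds at j = 0 at the
  latest.\<close>

lemma b_coeff_first: "d \<le> p \<Longrightarrow> b_coeff a d p d = int (a d)"
  by (simp add: b_coeff_def coeff_sum)

text \<open>Source of the starting value: nonnegativity means that p - d is at most the quotient of
  \<open>a (Suc d)\<close> by \<open>a d\<close>.\<close>

lemma b_coeff_second: "d < p \<Longrightarrow> b_coeff a d p (Suc d) = int (a (Suc d)) - int (p - d) * int (a d)"
  using coeff_linear_poly_power[of 1 "p - d" "1::int" 1]
  by (simp add: b_coeff_def coeff_sum coeff_monom_mult Suc_diff_le)

section \<open>Monomials and their number in each degree\<close>

abbreviation lookup where "lookup \<equiv> Poly_Mapping.lookup"
abbreviation keys where "keys \<equiv> Poly_Mapping.keys"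
abbreviation single where "single \<equiv> Poly_Mapping.single"

lemma keys_plus_nat: "keys (u + v) = keys u \<union> keys v" for u v :: mon
  by (auto simp: in_keys_iff lookup_add)

lemma mdeg_eq_sum: "finite A \<Longrightarrow> keys u \<subseteq> A \<Longrightarrow> mdeg u = (\<Sum>i\<in>A. lookup u i)"
  unfolding mdeg_def by (intro sum.mono_neutral_left) (auto simp: in_keys_iff)

lemma mdeg_plus: "mdeg (u + v) = mdeg u + mdeg v"
  using mdeg_eq_sum[of "keys u \<union> keys v"] by (simp add: keys_plus_nat lookup_add sum.distrib)

lemma mdeg_single [simp]: "mdeg (single i k) = k"
  by (simp add: mdeg_def)

lemma mdeg_zero [simp]: "mdeg 0 = 0"
  by (simp add: mdeg_def)

lemma mdeg_eq_0_iff: "mdeg u = 0 \<longleftrightarrow> u = 0"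
  by (auto simp: mdeg_def in_keys_iff intro: poly_mapping_eqI)

lemma mons_plus_iff: "u + v \<in> mons Z \<longleftrightarrow> u \<in> mons Z \<and> v \<in> mons Z"
  by (auto simp: mons_def keys_plus_nat)

definition mons_deg :: "nat set \<Rightarrow> nat \<Rightarrow> mon set" where
  "mons_deg Z k = {u \<in> mons Z. mdeg u = k}"

lemma mons_deg_0: "mons_deg Z 0 = {0}"
  by (auto simp: mons_deg_def mdeg_eq_0_iff mons_def)

lemma mons_deg_insert_Suc:
  assumes "z \<notin> Z"
  shows "mons_deg (insert z Z) (Suc k) = mons_deg Z (Suc k) \<union> (+) (single z 1) ` mons_deg (insert z Z) k"
proof (intro equalityI subsetI)
  fix u assume u: "u \<in> mons_deg (insert z Z) (Suc k)"
  show "u \<in> mons_deg Z (Suc k) \<union> (+) (single z 1) ` mons_deg (insert z Z) k"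
  proof (cases "z \<in> keys u")
    case True
    have eq: "u = single z 1 + (u - single z 1)"
      using True by (intro poly_mapping_eqI) (auto simp: lookup_add lookup_minus lookup_single in_keys_iff when_def)
    then have "mdeg (u - single z 1) = k" "u - single z 1 \<in> mons (insert z Z)"
      using u mdeg_plus[of "single z 1" "u - single z 1"] mons_plus_iff[of "single z 1" "u - single z 1"]
      by (simp_all add: mons_deg_def)
    then show ?thesis using eq by (auto simp: mons_deg_def)
  qed (use u in \<open>auto simp: mons_deg_def mons_def\<close>)
next
  fix u assume "u \<in> mons_deg Z (Suc k) \<union> (+) (single z 1) ` mons_deg (insert z Z) k"
  then show "u \<in> mons_deg (insert z Z) (Suc k)"
    by (auto simp: mons_deg_def mdeg_plus mons_plus_iff) (auto simp: mons_def)
qed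

text \<open>Splitting monomials by divisibility by the new variable gives the recursion that
  \<open>rec\<close> gives for the coefficients of powers of \<open>geom\<close>; the inner
  induction is on the degree.\<close>

lemma card_mons_deg:
  assumes "finite Z"
  shows "finite (mons_deg Z k) \<and> int (card (mons_deg Z k)) = geom ^ card Z $ k"
  using assms
proof (induction Z arbitrary: k)
  case empty
  have "mons_deg {} k = (if k = 0 then {0} else {})"
    by (auto simp: mons_deg_def mons_def)
  then show ?case by simp
next
  case (insert z Z)
  have rec: "geom ^ card Z = (1 - fps_X) * geom ^ card (insert z Z)"
    using insert.hyps one_minus_X_geom by (simp flip: mult.assoc)
  show ?case
  proof (induction k)
    case 0
    show ?case using insert.hyps by (simp add: mons_deg_0 fps_nth_power_0) (simp add: geom_def)
  next
    case (Suc k)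
    have "mons_deg Z (Suc k) \<inter> (+) (single z 1) ` mons_deg (insert z Z) k = {}"
      using insert.hyps by (auto simp: mons_deg_def mons_def keys_plus_nat)
    moreover have "inj_on ((+) (single z 1)) (mons_deg (insert z Z) k)"
      by (rule inj_onI) simp
    ultimately have "int (card (mons_deg (insert z Z) (Suc k)))
        = int (card (mons_deg Z (Suc k))) + int (card (mons_deg (insert z Z) k))"
      using insert Suc by (simp add: mons_deg_insert_Suc card_Un_disjoint card_image)
    also have "\<dots> = geom ^ card (insert z Z) $ Suc k"
      using insert.IH[of "Suc k"] Suc one_minus_X_mult_nth_Suc[of "geom ^ card (insert z Z)" k, folded rec]
      by linarith
    finally show ?case
      using insert Suc by (simp add: mons_deg_insert_Suc)
  qed
qed

lemma lookup_cscale [simp]: "lookup (cscale c f) u = c * lookup f u"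
  by (simp add: cscale_def lookup_mult lookup_single when_mult)

lemma lookup_mono_pol_mult: "lookup (mono_pol w * f) (w + u) = lookup f u"
  by (simp add: lookup_mult lookup_single when_mult)

lemma keys_mono_pol_mult: "keys (mono_pol w * f) = (+) w ` keys f" for f :: "'k::field mpol"
proof
  show "keys (mono_pol w * f) \<subseteq> (+) w ` keys f"
    using keys_mult[of "mono_pol w" f] by auto
  show "(+) w ` keys f \<subseteq> keys (mono_pol w * f)"
    by (auto simp: in_keys_iff lookup_mono_pol_mult)
qed

subsection \<open>Leading monomials and dimensions\<close>

text \<open>Leading monomials turn dimensions into cardinalities, see
  \<open>dim_eq_card_leads\<close>.\<close>

definition leads :: "'k::field mpol set \<Rightarrow> mon set" where
  "leads V = lex_lead ` (V - {0})"

lemma lex_lead_in_keys: "f \<noteq> 0 \<Longrightarrow> lex_lead f \<in> keys f"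
  unfolding lex_lead_def by (intro Max_in) auto

lemma lex_lead_ge: "u \<in> keys f \<Longrightarrow> u \<le> lex_lead f"
  unfolding lex_lead_def by (intro Max_ge) auto

lemma lookup_lex_lead: "f \<noteq> 0 \<Longrightarrow> lookup f (lex_lead f) \<noteq> 0"
  using lex_lead_in_keys by (metis in_keys_iff)

lemma lex_leadI: "u \<in> keys f \<Longrightarrow> (\<And>v. v \<in> keys f \<Longrightarrow> v \<le> u) \<Longrightarrow> lex_lead f = u"
  unfolding lex_lead_def by (intro Max_eqI) auto

text \<open>In a linear combination the largest leading monomial among the vectors with nonzero
  scalar cannot cancel.\<close>

lemma independent_if_distinct_leads:
  assumes "inj_on lex_lead B" "0 \<notin> B"
  shows "mpol_vs.independent B"
  unfolding mpol_vs.independent_explicit_module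
proof (intro allI impI, rule ccontr)
  fix t c and v :: "'a mpol"
  assume t: "finite t" "t \<subseteq> B" "(\<Sum>v\<in>t. cscale (c v) v) = 0" "v \<in> t" "c v \<noteq> 0"
  define t' where "t' = {v \<in> t. c v \<noteq> 0}"
  have t': "finite t'" "t' \<noteq> {}" "t' \<subseteq> t" using t by (auto simp: t'_def)
  then have "Max (lex_lead ` t') \<in> lex_lead ` t'" by (intro Max_in) auto
  then obtain w where w: "w \<in> t'" "lex_lead w = Max (lex_lead ` t')" by (metis imageE)
  have "lookup x (lex_lead w) = 0" if "x \<in> t'" "x \<noteq> w" for x
  proof (rule ccontr)
    assume "lookup x (lex_lead w) \<noteq> 0"
    then have "lex_lead w \<le> lex_lead x" by (intro lex_lead_ge) (simp add: in_keys_iff)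
    moreover have "lex_lead x \<le> lex_lead w" using that t' w by simp
    ultimately show False
      using assms(1) that w(1) t'(3) t(2) by (metis inj_onD order_antisym subset_iff)
  qed
  then have "0 = (\<Sum>x\<in>t'. if x = w then c w * lookup w (lex_lead w) else 0)"
  proof -
    have "0 = (\<Sum>x\<in>t. c x * lookup x (lex_lead w))"
      using arg_cong[OF t(3), of "\<lambda>f. lookup f (lex_lead w)"] by (simp add: lookup_sum)
    also have "\<dots> = (\<Sum>x\<in>t'. c x * lookup x (lex_lead w))"
      using t by (intro sum.mono_neutral_right) (auto simp: t'_def)
    also have "\<dots> = (\<Sum>x\<in>t'. if x = w then c w * lookup w (lex_lead w) else 0)"
      using \<open>\<And>x. x \<in> t' \<Longrightarrow> x \<noteq> w \<Longrightarrow> lookup x (lex_lead w) = 0\<close> by (intro sum.cong) auto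
    finally show ?thesis .
  qed
  then have "c w * lookup w (lex_lead w) = 0" using t'(1) w(1) by simp
  moreover have "w \<noteq> 0" using w(1) t'(3) t(2) assms(2) by auto
  ultimately show False using w(1) lookup_lex_lead[of w] by (simp add: t'_def)
qed

text \<open>Reduction: subtracting a multiple of some element of \<open>B\<close> lowers the leading
  monomial. The finite set \<open>W\<close> supplies the termination measure.\<close>

lemma subset_span_if_leads:
  assumes V: "mpol_vs.subspace V" and W: "finite W" "\<And>f. f \<in> V \<Longrightarrow> keys f \<subseteq> W"
    and B: "B \<subseteq> V" "leads V \<subseteq> leads B"
  shows "V \<subseteq> mpol_vs.span B"
proof
  fix f assume "f \<in> V"
  then show "f \<in> mpol_vs.span B"
  proof (induction "card {w \<in> W. w \<le> lex_lead f}" arbitrary: f rule: less_induct)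
    case less
    show ?case
    proof (cases "f = 0")
      case True
      then show ?thesis by (simp add: mpol_vs.span_zero)
    next
      case False
      with less.prems B(2) obtain b where b: "b \<in> B" "b \<noteq> 0" "lex_lead b = lex_lead f"
        unfolding leads_def by force
      define l where "l = lex_lead f"
      define c where "c = lookup f l / lookup b l"
      define g where "g = f - cscale c b"
      have "lookup b l \<noteq> 0" using b lookup_lex_lead l_def by metis
      then have gl: "lookup g l = 0" by (simp add: g_def c_def lookup_minus)
      have gV: "g \<in> V"
        unfolding g_def using V less.prems b(1) B(1)
        by (intro mpol_vs.subspace_diff mpol_vs.subspace_scale) auto
      have "g \<in> mpol_vs.span B"
      proof (cases "g = 0")
        case True
        then show ?thesis by (simp add: mpol_vs.span_zero)
      next
        case g0: False
        have "lex_lead g \<in> keys g" using g0 by (rule lex_lead_in_keys)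
        then have "lex_lead g \<in> keys f \<union> keys b" "lex_lead g \<noteq> l"
          using gl by (auto simp: g_def in_keys_iff lookup_minus)
        then have "lex_lead g < l"
          using lex_lead_ge[of "lex_lead g" f] lex_lead_ge[of "lex_lead g" b] b(3) l_def by auto
        moreover have "l \<in> W" using W(2)[OF less.prems] lex_lead_in_keys[OF False] l_def by auto
        ultimately have "{w \<in> W. w \<le> lex_lead g} \<subseteq> {w \<in> W. w \<le> l}"
          "l \<in> {w \<in> W. w \<le> l}" "l \<notin> {w \<in> W. w \<le> lex_lead g}" by auto
        then have "{w \<in> W. w \<le> lex_lead g} \<subset> {w \<in> W. w \<le> l}" by blast
        then have "card {w \<in> W. w \<le> lex_lead g} < card {w \<in> W. w \<le> lex_lead f}"
          using W(1) l_def by (intro psubset_card_mono) auto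
        then show ?thesis using gV by (rule less.hyps)
      qed
      moreover have "cscale c b \<in> mpol_vs.span B"
        using b(1) by (intro mpol_vs.span_scale mpol_vs.span_base)
      ultimately have "g + cscale c b \<in> mpol_vs.span B" by (rule mpol_vs.span_add)
      then show ?thesis by (simp add: g_def)
    qed
  qed
qed

text \<open>One element of \<open>V\<close> chosen for each leading monomial gives a basis.\<close>

lemma dim_eq_card_leads:
  assumes V: "mpol_vs.subspace V" and W: "finite W" "\<And>f. f \<in> V \<Longrightarrow> keys f \<subseteq> W"
  shows "mpol_vs.dim V = card (leads V)"
proof -
  have "\<exists>f. f \<in> V \<and> f \<noteq> 0 \<and> lex_lead f = l" if "l \<in> leads V" for l
    using that by (auto simp: leads_def)
  then obtain F where F: "\<And>l. l \<in> leads V \<Longrightarrow> F l \<in> V \<and> F l \<noteq> 0 \<and> lex_lead (F l) = l"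
    by metis
  have inj: "inj_on F (leads V)" using F by (metis inj_onI)
  show ?thesis
  proof (rule mpol_vs.dim_unique)
    show "F ` leads V \<subseteq> V" using F by auto
    have "leads V \<subseteq> leads (F ` leads V)"
      using F unfolding leads_def[of "F ` leads V"] by (auto simp: image_iff)
    then show "V \<subseteq> mpol_vs.span (F ` leads V)"
      using F by (intro subset_span_if_leads[OF V W]) auto
    show "mpol_vs.independent (F ` leads V)"
      using F by (intro independent_if_distinct_leads) (auto simp: inj_on_def)
    show "card (F ` leads V) = card (leads V)" using inj by (rule card_image)
  qed
qed

subsection \<open>Graded subspaces\<close>

text \<open>Hilbert functions and decompositions see only the graded vector space, so
  \<open>I\<close>, \<open>L\<close> and \<open>L\<sigma>\<close> are treated alike at this
  level.\<close>

definition graded_subspace :: "nat \<Rightarrow> 'k::field mpol set \<Rightarrow> bool" where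
  "graded_subspace n V \<longleftrightarrow>
     mpol_vs.subspace V \<and> V \<subseteq> polys {1..n} \<and> (\<forall>f\<in>V. \<forall>k. hcomp k f \<in> V)"

lemma lookup_hcomp: "lookup (hcomp k f) u = (lookup f u when mdeg u = k)"
  by (auto simp: hcomp_def lookup_sum lookup_single when_def in_keys_iff)

lemma homog_hcomp: "homog k (hcomp k f)"
  by (auto simp: homog_def in_keys_iff lookup_hcomp when_def split: if_splits)

lemma keys_hcomp: "keys (hcomp k f) = {u \<in> keys f. mdeg u = k}"
  by (auto simp: in_keys_iff lookup_hcomp when_def split: if_splits)

lemma sum_hcomp: "(\<Sum>k\<in>mdeg ` keys f. hcomp k f) = f"
  by (intro poly_mapping_eqI) (auto simp: lookup_sum lookup_hcomp when_def in_keys_iff image_iff)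

lemma subspace_homog: "mpol_vs.subspace V \<Longrightarrow> mpol_vs.subspace {f \<in> V. homog k f}"
  unfolding mpol_vs.subspace_def
  by (auto simp: homog_def in_keys_iff lookup_add)

lemma keys_homog_subset: "f \<in> polys Z \<Longrightarrow> homog k f \<Longrightarrow> keys f \<subseteq> mons_deg Z k"
  by (auto simp: polys_def homog_def mons_deg_def)

text \<open>The lexicographic order does not refine the degree, but the component of f in the degree
  of its leading monomial keeps that monomial and stays in \<open>V\<close>.\<close>

lemma leads_homog:
  assumes "graded_subspace n V"
  shows "leads {f \<in> V. homog k f} = {l \<in> leads V. mdeg l = k}"
proof (intro equalityI subsetI)
  fix l assume "l \<in> leads {f \<in> V. homog k f}"
  then show "l \<in> {l \<in> leads V. mdeg l = k}"
    by (auto simp: leads_def homog_def dest: lex_lead_in_keys)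
next
  fix l assume "l \<in> {l \<in> leads V. mdeg l = k}"
  then obtain f where f: "f \<in> V" "f \<noteq> 0" "lex_lead f = l" "mdeg l = k" by (auto simp: leads_def)
  then have l: "l \<in> keys (hcomp k f)" using lex_lead_in_keys by (auto simp: keys_hcomp)
  then have "lex_lead (hcomp k f) = l"
    using f(3) lex_lead_ge[of _ f] by (intro lex_leadI) (auto simp: keys_hcomp)
  moreover have "hcomp k f \<in> V" "hcomp k f \<noteq> 0"
    using assms f(1) l by (auto simp: graded_subspace_def)
  ultimately show "l \<in> leads {f \<in> V. homog k f}"
    using homog_hcomp[of k f] unfolding leads_def by (intro image_eqI[of _ _ "hcomp k f"]) auto
qed

lemma hilbert_fun_eq_card_leads:
  assumes "graded_subspace n V"
  shows "hilbert_fun V k = card {l \<in> leads V. mdeg l = k}"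
proof -
  have "mpol_vs.dim {f \<in> V. homog k f} = card (leads {f \<in> V. homog k f})"
  proof (rule dim_eq_card_leads)
    show "mpol_vs.subspace {f \<in> V. homog k f}"
      using assms by (intro subspace_homog) (simp add: graded_subspace_def)
    show "finite (mons_deg {1..n} k)" using card_mons_deg by blast
    show "keys f \<subseteq> mons_deg {1..n} k" if "f \<in> {f \<in> V. homog k f}" for f
      using that assms keys_homog_subset unfolding graded_subspace_def by blast
  qed
  then show ?thesis using leads_homog[OF assms] by (simp add: hilbert_fun_def)
qed

subsection \<open>Hilbert decompositions and Hilbert series\<close>

text \<open>Indexes the monomial basis of the direct sum: (i, u) is the monomial u in the i-th
  summand, \<open>index_deg\<close> its shifted degree, \<open>dsum_unit\<close> the basis
  element.\<close>

definition dsum_index :: "(nat set \<times> nat) list \<Rightarrow> (nat \<times> mon) set" where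
  "dsum_index D = {(i, u). i < length D \<and> u \<in> mons (fst (D ! i))}"

definition index_deg :: "(nat set \<times> nat) list \<Rightarrow> nat \<times> mon \<Rightarrow> nat" where
  "index_deg D x = mdeg (snd x) + snd (D ! fst x)"

definition dsum_unit :: "nat \<times> mon \<Rightarrow> nat \<Rightarrow> 'k::field mpol" where
  "dsum_unit x j = (if j = fst x then mono_pol (snd x) else 0)"

definition dsum_series :: "(nat set \<times> nat) list \<Rightarrow> int fps" where
  "dsum_series D = (\<Sum>(Z, s)\<leftarrow>D. fps_X ^ s * geom ^ card Z)"

definition hilbert_series :: "'k::field mpol set \<Rightarrow> int fps" where
  "hilbert_series V = Abs_fps (\<lambda>k. int (hilbert_fun V k))"

lemma card_dsum_index:
  assumes "\<And>Z s. (Z, s) \<in> set D \<Longrightarrow> finite Z"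
  shows "finite {x \<in> dsum_index D. index_deg D x = k}
    \<and> int (card {x \<in> dsum_index D. index_deg D x = k}) = dsum_series D $ k"
proof -
  \<comment> \<open>Without the case distinction a shift beyond k would truncate to degree 0 and
    count the monomial 1.\<close>
  define A where "A i = (if snd (D ! i) \<le> k then mons_deg (fst (D ! i)) (k - snd (D ! i)) else {})" for i
  have eq: "{x \<in> dsum_index D. index_deg D x = k} = (SIGMA i:{..<length D}. A i)"
    by (auto simp: dsum_index_def index_deg_def A_def mons_deg_def split: if_splits)
  have A: "finite (A i) \<and> int (card (A i)) = (fps_X ^ snd (D ! i) * geom ^ card (fst (D ! i))) $ k"
    if "i < length D" for i
    using that assms[of "fst (D ! i)" "snd (D ! i)"] card_mons_deg[of "fst (D ! i)"]
    by (auto simp: A_def fps_X_power_mult_nth)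
  then have "int (card (SIGMA i:{..<length D}. A i))
      = (\<Sum>i<length D. (fps_X ^ snd (D ! i) * geom ^ card (fst (D ! i))) $ k)"
    by (simp add: card_SigmaI)
  also have "\<dots> = dsum_series D $ k"
    by (simp add: dsum_series_def sum_list_sum_nth atLeast0LessThan fps_sum_nth split_beta)
  finally have "int (card (SIGMA i:{..<length D}. A i)) = dsum_series D $ k" .
  moreover have "finite (SIGMA i:{..<length D}. A i)" using A by (intro finite_SigmaI) auto
  ultimately show ?thesis by (simp add: eq)
qed

lemma dsum_unit_in_dsum_comp:
  "x \<in> dsum_index D \<Longrightarrow> dsum_unit x \<in> dsum_comp D (index_deg D x)"
  by (auto simp: dsum_comp_def dsum_def dsum_unit_def dsum_index_def index_deg_def polys_def)

lemma dsum_comp_eq_combination: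
  fixes w :: "nat \<Rightarrow> 'k::field mpol"
  assumes w: "w \<in> dsum_comp D k" and fin: "finite {x \<in> dsum_index D. index_deg D x = k}"
  shows "w = (\<lambda>j. \<Sum>x\<in>{x \<in> dsum_index D. index_deg D x = k}. cscale (lookup (w (fst x)) (snd x)) (dsum_unit x j))"
proof (rule ext, rule poly_mapping_eqI)
  fix j v
  let ?E = "{x \<in> dsum_index D. index_deg D x = k}"
  have "lookup (\<Sum>x\<in>?E. cscale (lookup (w (fst x)) (snd x)) (dsum_unit x j)) v
      = (\<Sum>x\<in>?E. if x = (j, v) then lookup (w j) v else 0)"
    unfolding lookup_sum
    by (intro sum.cong) (auto simp: dsum_unit_def lookup_single when_def)
  also have "\<dots> = (if (j, v) \<in> ?E then lookup (w j) v else 0)"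
    using fin by simp
  also have "\<dots> = lookup (w j) v"
    using w by (auto simp: dsum_comp_def dsum_def dsum_index_def index_deg_def polys_def in_keys_iff)
      (metis in_keys_iff lookup_zero not_le_imp_less subset_iff)+
  finally show "lookup (w j) v = lookup (\<Sum>x\<in>?E. cscale (lookup (w (fst x)) (snd x)) (dsum_unit x j)) v" ..
qed

lemma graded_iso_combination:
  assumes iso: "graded_iso V D \<phi>" and V: "mpol_vs.subspace V"
    and fin: "finite E" and b: "\<And>x. x \<in> E \<Longrightarrow> b x \<in> V"
  shows "\<phi> (\<Sum>x\<in>E. cscale (c x) (b x)) = (\<lambda>j. \<Sum>x\<in>E. cscale (c x) (\<phi> (b x) j))"
  using fin b
proof (induction E rule: finite_induct)
  case empty
  \<comment> \<open>The value at 0 is obtained from compatibility with the scalar 0.\<close>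
  have "\<phi> (cscale 0 0) = (\<lambda>j. cscale 0 (\<phi> 0 j))"
    using iso mpol_vs.subspace_0[OF V] unfolding graded_iso_def by blast
  then show ?case by simp
next
  case (insert y E)
  have "cscale (c y) (b y) \<in> V" "(\<Sum>x\<in>E. cscale (c x) (b x)) \<in> V"
    using V insert.prems by (auto intro!: mpol_vs.subspace_scale mpol_vs.subspace_sum)
  then have "\<phi> (cscale (c y) (b y) + (\<Sum>x\<in>E. cscale (c x) (b x)))
      = (\<lambda>j. \<phi> (cscale (c y) (b y)) j + \<phi> (\<Sum>x\<in>E. cscale (c x) (b x)) j)"
    using iso unfolding graded_iso_def by blast
  moreover have "\<phi> (cscale (c y) (b y)) = (\<lambda>j. cscale (c y) (\<phi> (b y) j))"
    using iso insert.prems unfolding graded_iso_def by blast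
  ultimately show ?case using insert by simp
qed

text \<open>The preimages of the monomials of degree k in the direct sum form a basis of the degree
  k part of \<open>V\<close>.\<close>

lemma hilbert_fun_if_graded_iso:
  fixes V :: "'k::field mpol set"
  assumes iso: "graded_iso V D \<phi>" and V: "mpol_vs.subspace V"
    and fin: "finite {x \<in> dsum_index D. index_deg D x = k}"
  shows "hilbert_fun V k = card {x \<in> dsum_index D. index_deg D x = k}"
proof -
  define E where "E = {x \<in> dsum_index D. index_deg D x = k}"
  have finE: "finite E" using fin E_def by simp
  have img: "\<phi> ` {f \<in> V. homog k f} = dsum_comp D k" and inj: "inj_on \<phi> V"
    using iso by (auto simp: graded_iso_def bij_betw_def)
  have "\<exists>f. f \<in> V \<and> homog k f \<and> \<phi> f = dsum_unit x" if "x \<in> E" for x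
  proof -
    have "dsum_unit x \<in> \<phi> ` {f \<in> V. homog k f}"
      using that dsum_unit_in_dsum_comp[of x D] unfolding img by (simp add: E_def)
    then show ?thesis by force
  qed
  then obtain b where b: "\<And>x. x \<in> E \<Longrightarrow> b x \<in> V \<and> homog k (b x) \<and> \<phi> (b x) = dsum_unit x"
    by metis
  have comb: "\<phi> (\<Sum>x\<in>E. cscale (c x) (b x)) = (\<lambda>j. \<Sum>x\<in>E. cscale (c x) (dsum_unit x j))" for c
    using graded_iso_combination[OF iso V finE, of b c] b by simp
  have coef: "lookup (\<phi> (\<Sum>x\<in>E. cscale (c x) (b x)) (fst y)) (snd y) = c y" if "y \<in> E" for c y
  proof -
    have "lookup (\<phi> (\<Sum>x\<in>E. cscale (c x) (b x)) (fst y)) (snd y) = (\<Sum>x\<in>E. if x = y then c y else 0)"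
      unfolding comb lookup_sum
      by (intro sum.cong) (auto simp: dsum_unit_def lookup_single when_def prod_eq_iff)
    then show ?thesis using finE that by simp
  qed
  have phi0: "\<phi> 0 = (\<lambda>_. 0)"
    using graded_iso_combination[OF iso V, of "{}" b] by simp
  have injb: "inj_on b E"
  proof (rule inj_onI)
    fix x y assume xy: "x \<in> E" "y \<in> E" "b x = b y"
    then have "(dsum_unit x :: nat \<Rightarrow> 'k mpol) = dsum_unit y" using b by metis
    then have "lookup (dsum_unit x (fst x) :: 'k mpol) (snd x) = lookup (dsum_unit y (fst x)) (snd x)"
      by simp
    then show "x = y" by (auto simp: dsum_unit_def lookup_single when_def prod_eq_iff split: if_splits)
  qed
  have "mpol_vs.dim {f \<in> V. homog k f} = card (b ` E)"
  proof (rule mpol_vs.dim_unique)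
    show "b ` E \<subseteq> {f \<in> V. homog k f}" using b by auto
    show "mpol_vs.independent (b ` E)"
    proof (rule mpol_vs.independent_if_scalars_zero)
      fix c v assume 0: "(\<Sum>v\<in>b ` E. cscale (c v) v) = 0" and "v \<in> b ` E"
      then obtain y where y: "y \<in> E" "v = b y" by auto
      have "(\<Sum>x\<in>E. cscale (c (b x)) (b x)) = 0" using 0 injb by (simp add: sum.reindex)
      then show "c v = 0" using coef[OF y(1), of "\<lambda>x. c (b x)"] y(2) by (simp add: phi0)
    qed (use finE in simp)
    show "{f \<in> V. homog k f} \<subseteq> mpol_vs.span (b ` E)"
    proof
      fix f assume f: "f \<in> {f \<in> V. homog k f}"
      define g where "g = (\<Sum>x\<in>E. cscale (lookup (\<phi> f (fst x)) (snd x)) (b x))"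
      have "\<phi> f \<in> dsum_comp D k" using f img by blast
      then have "\<phi> f = \<phi> g"
        unfolding g_def comb using dsum_comp_eq_combination fin unfolding E_def by blast
      moreover have "g \<in> V"
        using V b unfolding g_def by (intro mpol_vs.subspace_sum mpol_vs.subspace_scale) auto
      ultimately have "f = g" using f inj by (auto dest: inj_onD)
      also have "g \<in> mpol_vs.span (b ` E)"
        unfolding g_def by (intro mpol_vs.span_sum mpol_vs.span_scale mpol_vs.span_base) auto
      finally show "f \<in> mpol_vs.span (b ` E)" .
    qed
  qed simp
  then show ?thesis using injb by (simp add: hilbert_fun_def card_image E_def)
qed

text \<open>Choosing homogeneous representatives of the leading monomials yields one basis of
  \<open>V\<close> that restricts to a basis in every degree, as a single isomorphism
  requires.\<close>

lemma graded_basis_exists: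
  fixes V :: "'k::field mpol set"
  assumes V: "graded_subspace n V"
  obtains F where "\<And>l. l \<in> leads V \<Longrightarrow> F l \<in> V \<and> homog (mdeg l) (F l)"
    "inj_on F (leads V)" "mpol_vs.independent (F ` leads V)"
    "\<And>k. {f \<in> V. homog k f} \<subseteq> mpol_vs.span (F ` {l \<in> leads V. mdeg l = k})"
    "V \<subseteq> mpol_vs.span (F ` leads V)"
proof -
  have "\<exists>f. f \<in> V \<and> homog (mdeg l) f \<and> f \<noteq> 0 \<and> lex_lead f = l" if "l \<in> leads V" for l
    using that leads_homog[OF V, of "mdeg l"] unfolding leads_def by force
  then obtain F where F: "\<And>l. l \<in> leads V \<Longrightarrow> F l \<in> V \<and> homog (mdeg l) (F l) \<and> F l \<noteq> 0 \<and> lex_lead (F l) = l"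
    by metis
  have span: "{f \<in> V. homog k f} \<subseteq> mpol_vs.span (F ` {l \<in> leads V. mdeg l = k})" for k
  proof (rule subset_span_if_leads)
    show "mpol_vs.subspace {f \<in> V. homog k f}"
      using V by (intro subspace_homog) (simp add: graded_subspace_def)
    show "finite (mons_deg {1..n} k)" using card_mons_deg by blast
    show "keys f \<subseteq> mons_deg {1..n} k" if "f \<in> {f \<in> V. homog k f}" for f
      using that V keys_homog_subset unfolding graded_subspace_def by blast
    show "F ` {l \<in> leads V. mdeg l = k} \<subseteq> {f \<in> V. homog k f}" using F by auto
    have "l \<in> leads (F ` {l \<in> leads V. mdeg l = k})" if "l \<in> leads V" "mdeg l = k" for l
      unfolding leads_def[of "F ` _"] using F[OF that(1)] that by (intro image_eqI[of _ _ "F l"]) auto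
    then show "leads {f \<in> V. homog k f} \<subseteq> leads (F ` {l \<in> leads V. mdeg l = k})"
      unfolding leads_homog[OF V] by blast
  qed
  show ?thesis
  proof (rule that)
    show "F l \<in> V \<and> homog (mdeg l) (F l)" if "l \<in> leads V" for l using F[OF that] by blast
    show "inj_on F (leads V)" using F by (metis inj_onI)
    show "mpol_vs.independent (F ` leads V)"
      using F by (intro independent_if_distinct_leads) (auto simp: inj_on_def)
    show "{f \<in> V. homog k f} \<subseteq> mpol_vs.span (F ` {l \<in> leads V. mdeg l = k})" for k by (rule span)
    show "V \<subseteq> mpol_vs.span (F ` leads V)"
    proof
      fix f assume f: "f \<in> V"
      have "hcomp k f \<in> mpol_vs.span (F ` leads V)" for k
      proof -
        have "hcomp k f \<in> {f \<in> V. homog k f}"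
          using V f homog_hcomp by (auto simp: graded_subspace_def)
        then have "hcomp k f \<in> mpol_vs.span (F ` {l \<in> leads V. mdeg l = k})" using span by blast
        also have "\<dots> \<subseteq> mpol_vs.span (F ` leads V)" by (intro mpol_vs.span_mono) auto
        finally show ?thesis .
      qed
      then have "(\<Sum>k\<in>mdeg ` keys f. hcomp k f) \<in> mpol_vs.span (F ` leads V)"
        by (intro mpol_vs.span_sum)
      then show "f \<in> mpol_vs.span (F ` leads V)" by (simp add: sum_hcomp)
    qed
  qed
qed


text \<open>Match the homogeneous basis of \<open>V\<close> with the monomial basis of the direct
  sum degree by degree; the isomorphism sends f to its coordinates.\<close>

lemma graded_iso_exists:
  fixes V :: "'k::field mpol set"
  assumes V: "graded_subspace n V"
    and fin: "\<And>k. finite {x \<in> dsum_index D. index_deg D x = k}"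
    and card: "\<And>k. hilbert_fun V k = card {x \<in> dsum_index D. index_deg D x = k}"
    and finleads: "\<And>k. finite {l \<in> leads V. mdeg l = k}"
  shows "\<exists>\<phi>. graded_iso V D \<phi>"
proof -
  obtain F where F: "\<And>l. l \<in> leads V \<Longrightarrow> F l \<in> V \<and> homog (mdeg l) (F l)"
    and injF: "inj_on F (leads V)" and ind: "mpol_vs.independent (F ` leads V)"
    and spank: "\<And>k. {f \<in> V. homog k f} \<subseteq> mpol_vs.span (F ` {l \<in> leads V. mdeg l = k})"
    and span: "V \<subseteq> mpol_vs.span (F ` leads V)"
    by (rule graded_basis_exists[OF V]) (rule that)
  have ex: "\<exists>h. bij_betw h {x \<in> dsum_index D. index_deg D x = k} {l \<in> leads V. mdeg l = k}" for k
    using fin finleads card hilbert_fun_eq_card_leads[OF V] by (intro finite_same_card_bij) auto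
  define h where
    "h k = (SOME h. bij_betw h {x \<in> dsum_index D. index_deg D x = k} {l \<in> leads V. mdeg l = k})" for k
  have h: "bij_betw (h k) {x \<in> dsum_index D. index_deg D x = k} {l \<in> leads V. mdeg l = k}" for k
    unfolding h_def by (rule someI_ex[OF ex])
  \<comment> \<open>The degreewise bijections glue, since both index sets are disjoint unions over
    the degrees.\<close>
  define H where "H x = h (index_deg D x) x" for x
  have H: "H x \<in> leads V" "mdeg (H x) = index_deg D x" if "x \<in> dsum_index D" for x
    using that h[of "index_deg D x"] unfolding bij_betw_def H_def by auto
  have injH: "inj_on H (dsum_index D)"
  proof (rule inj_onI)
    fix x y assume xy: "x \<in> dsum_index D" "y \<in> dsum_index D" "H x = H y"
    then have "index_deg D x = index_deg D y" using H(2) by metis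
    then show "x = y"
      using xy h[of "index_deg D x"] unfolding bij_betw_def H_def by (auto dest: inj_onD)
  qed
  have surjH: "H ` dsum_index D = leads V"
  proof (intro equalityI subsetI)
    fix l assume "l \<in> leads V"
    then have "l \<in> h (mdeg l) ` {x \<in> dsum_index D. index_deg D x = mdeg l}"
      using h[of "mdeg l"] unfolding bij_betw_def by simp
    then show "l \<in> H ` dsum_index D" by (force simp: H_def)
  qed (use H in auto)
  define b where "b x = F (H x)" for x
  let ?B = "F ` leads V"
  have injb: "inj_on b (dsum_index D)"
    using injF injH surjH comp_inj_on[of H "dsum_index D" F] by (simp add: b_def[abs_def] o_def)
  have imgb: "b ` dsum_index D = ?B"
    by (auto simp: b_def simp flip: surjH)
  have b: "b x \<in> V" "homog (index_deg D x) (b x)" "b x \<in> ?B" if "x \<in> dsum_index D" for x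
    using H[OF that] F[OF H(1)[OF that]] by (auto simp: b_def)
  have sub: "mpol_vs.subspace V" using V by (simp add: graded_subspace_def)
  define R where "R f x = mpol_vs.representation ?B f (b x)" for f x
  define \<phi> where "\<phi> f i = Abs_poly_mapping (\<lambda>u. if (i, u) \<in> dsum_index D then R f (i, u) else 0)" for f i
  \<comment> \<open>\<open>Abs_poly_mapping\<close> needs finite support; it is inherited from the
    representation through the injective \<open>b\<close>.\<close>
  have lookup_phi: "lookup (\<phi> f i) u = (if (i, u) \<in> dsum_index D then R f (i, u) else 0)" for f i u
  proof -
    have "inj_on (\<lambda>u. b (i, u)) {u. (i, u) \<in> dsum_index D \<and> R f (i, u) \<noteq> 0}"
      using injb by (auto simp: inj_on_def)
    moreover have "(\<lambda>u. b (i, u)) ` {u. (i, u) \<in> dsum_index D \<and> R f (i, u) \<noteq> 0}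
        \<subseteq> {v. mpol_vs.representation ?B f v \<noteq> 0}"
      by (auto simp: R_def)
    ultimately have "finite {u. (i, u) \<in> dsum_index D \<and> R f (i, u) \<noteq> 0}"
      using mpol_vs.finite_representation inj_on_finite by blast
    then have "finite {u. (if (i, u) \<in> dsum_index D then R f (i, u) else 0) \<noteq> 0}"
      by (rule rev_finite_subset) (auto split: if_splits)
    then show ?thesis by (simp add: \<phi>_def)
  qed
  have R_add: "R (f + g) x = R f x + R g x" if "f \<in> V" "g \<in> V" for f g x
    using mpol_vs.representation_add[OF ind, of g f] subsetD[OF span that(1)] subsetD[OF span that(2)]
    by (simp add: R_def add.commute)
  have R_scale: "R (cscale c f) x = c * R f x" if "f \<in> V" for f c x
    using mpol_vs.representation_scale[OF ind, of f c] subsetD[OF span that] by (simp add: R_def)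
  have phi_in: "\<phi> f \<in> dsum D" for f
    by (auto simp: dsum_def polys_def in_keys_iff lookup_phi dsum_index_def split: if_splits
        intro!: poly_mapping_eqI)
  have phi_homog: "\<phi> f \<in> dsum_comp D k" if f: "f \<in> V" "homog k f" for f k
  proof -
    \<comment> \<open>An element of degree k is already spanned by the basis elements of degree k,
      so its other coordinates vanish.\<close>
    have R0: "index_deg D x = k" if "x \<in> dsum_index D" "R f x \<noteq> 0" for x
    proof -
      have "f \<in> mpol_vs.span (F ` {l \<in> leads V. mdeg l = k})" using f spank by blast
      then have "R f x = mpol_vs.representation (F ` {l \<in> leads V. mdeg l = k}) f (b x)"
        unfolding R_def by (subst mpol_vs.representation_extend[OF ind]) auto
      then have "b x \<in> F ` {l \<in> leads V. mdeg l = k}"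
        using that(2) mpol_vs.representation_ne_zero by metis
      then have "mdeg (H x) = k"
        using injF H(1)[OF that(1)] by (auto simp: b_def dest: inj_onD)
      then show ?thesis using H(2)[OF that(1)] by simp
    qed
    have "mdeg u + snd (D ! i) = k" if "u \<in> keys (\<phi> f i)" for i u
      using that R0[of "(i, u)"] by (auto simp: in_keys_iff lookup_phi index_deg_def split: if_splits)
    then show ?thesis using phi_in by (auto simp: dsum_comp_def)
  qed
  have inj: "inj_on \<phi> V"
  proof (rule inj_onI)
    fix f g assume fg: "f \<in> V" "g \<in> V" "\<phi> f = \<phi> g"
    have "mpol_vs.representation ?B f v = mpol_vs.representation ?B g v" for v
    proof (cases "v \<in> ?B")
      case True
      then obtain x where x: "x \<in> dsum_index D" "v = b x" using imgb by blast
      have "lookup (\<phi> f (fst x)) (snd x) = lookup (\<phi> g (fst x)) (snd x)" using fg(3) by simp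
      then show ?thesis using x by (simp add: lookup_phi R_def)
    next
      case False
      then show ?thesis using mpol_vs.representation_ne_zero by metis
    qed
    then have eq: "mpol_vs.representation ?B f = mpol_vs.representation ?B g" by (rule ext)
    show "f = g"
      using mpol_vs.sum_nonzero_representation_eq[OF ind subsetD[OF span fg(1)], unfolded eq]
        mpol_vs.sum_nonzero_representation_eq[OF ind subsetD[OF span fg(2)]] by (rule trans[OF sym])
  qed
  \<comment> \<open>The clause on \<open>homog\<close> supplies the inclusion of
    \<open>dsum_comp D k\<close> in the image of the degree k part.\<close>
  have surj: "\<exists>f\<in>V. \<phi> f = w \<and> (\<forall>k. w \<in> dsum_comp D k \<longrightarrow> homog k f)" if w: "w \<in> dsum D" for w
  proof -
    define S where "S = (SIGMA i:{..<length D}. keys (w i))"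
    have S: "finite S" "S \<subseteq> dsum_index D"
      using w by (auto simp: S_def dsum_def dsum_index_def polys_def)
    define f where "f = (\<Sum>x\<in>S. cscale (lookup (w (fst x)) (snd x)) (b x))"
    have fV: "f \<in> V"
      unfolding f_def using b S by (intro mpol_vs.subspace_sum mpol_vs.subspace_scale sub) auto
    have R: "R f y = (if y \<in> S then lookup (w (fst y)) (snd y) else 0)" if y: "y \<in> dsum_index D" for y
    proof -
      have "R f y = (\<Sum>x\<in>S. mpol_vs.representation ?B (cscale (lookup (w (fst x)) (snd x)) (b x)) (b y))"
        unfolding R_def f_def using b(1) S(2) span sub
        by (subst mpol_vs.representation_sum[OF ind]) (auto intro!: mpol_vs.span_scale)
      also have "\<dots> = (\<Sum>x\<in>S. if x = y then lookup (w (fst y)) (snd y) else 0)"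
      proof (rule sum.cong)
        fix x assume "x \<in> S"
        then have x: "x \<in> dsum_index D" using S by auto
        then have "mpol_vs.representation ?B (cscale (lookup (w (fst x)) (snd x)) (b x)) (b y)
            = lookup (w (fst x)) (snd x) * (if b y = b x then 1 else 0)"
          using b(1,3)[OF x] span ind
          by (subst mpol_vs.representation_scale) (auto simp: mpol_vs.representation_basis)
        then show "mpol_vs.representation ?B (cscale (lookup (w (fst x)) (snd x)) (b x)) (b y)
            = (if x = y then lookup (w (fst y)) (snd y) else 0)"
          using injb x y by (auto dest: inj_onD)
      qed simp
      finally show ?thesis using S(1) by simp
    qed
    have "\<phi> f = w"
    proof (rule ext, rule poly_mapping_eqI)
      fix i u
      have "lookup (\<phi> f i) u = (if (i, u) \<in> S then lookup (w i) u else 0)"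
        using R[of "(i, u)"] S(2) by (auto simp: lookup_phi)
      also have "\<dots> = lookup (w i) u"
        using w by (auto simp: S_def in_keys_iff dsum_def)
      finally show "lookup (\<phi> f i) u = lookup (w i) u" .
    qed
    moreover have "homog k f" if wk: "w \<in> dsum_comp D k" for k
    proof -
      have "f \<in> {f \<in> V. homog k f}"
        unfolding f_def
      proof (intro mpol_vs.subspace_sum mpol_vs.subspace_scale subspace_homog[OF sub])
        fix x assume x: "x \<in> S"
        then have "index_deg D x = k"
          using wk by (auto simp: S_def dsum_comp_def index_deg_def)
        then show "b x \<in> {f \<in> V. homog k f}" using b[of x] x S(2) by auto
      qed
      then show ?thesis by simp
    qed
    ultimately show ?thesis using fV by blast
  qed
  have "graded_iso V D \<phi>"
    unfolding graded_iso_def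
  proof (intro conjI allI ballI)
    show "bij_betw \<phi> V (dsum D)"
      unfolding bij_betw_def using inj phi_in surj by blast
    show "\<phi> (f + g) = (\<lambda>i. \<phi> f i + \<phi> g i)" if "f \<in> V" "g \<in> V" for f g
      using R_add[OF that] by (intro ext poly_mapping_eqI) (simp add: lookup_phi lookup_add)
    show "\<phi> (cscale c f) = (\<lambda>i. cscale c (\<phi> f i))" if "f \<in> V" for c f
      using R_scale[OF that] by (intro ext poly_mapping_eqI) (simp add: lookup_phi)
    show "\<phi> ` {f \<in> V. homog k f} = dsum_comp D k" for k
    proof (intro equalityI subsetI)
      fix w :: "nat \<Rightarrow> 'k mpol" assume w: "w \<in> dsum_comp D k"
      then have "w \<in> dsum D" by (simp add: dsum_comp_def)
      then obtain f where "f \<in> V" "\<phi> f = w" "homog k f" using surj w by blast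
      then show "w \<in> \<phi> ` {f \<in> V. homog k f}" by auto
    qed (use phi_homog in auto)
  qed
  then show ?thesis by blast
qed

lemma finite_leads_deg:
  assumes "graded_subspace n V"
  shows "finite {l \<in> leads V. mdeg l = k}"
proof (rule finite_subset)
  show "{l \<in> leads V. mdeg l = k} \<subseteq> mons_deg {1..n} k"
    using assms lex_lead_in_keys by (fastforce simp: leads_def graded_subspace_def polys_def mons_deg_def)
  show "finite (mons_deg {1..n} k)" using card_mons_deg by blast
qed

lemma hilbert_decomp_iff:
  assumes V: "graded_subspace n V"
  shows "hilbert_decomp n V D \<longleftrightarrow> (\<forall>(Z, s)\<in>set D. Z \<subseteq> {1..n}) \<and> hilbert_series V = dsum_series D"
proof (cases "\<forall>(Z, s)\<in>set D. Z \<subseteq> {1..n}")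
  case True
  then have D: "finite {x \<in> dsum_index D. index_deg D x = k}"
    "int (card {x \<in> dsum_index D. index_deg D x = k}) = dsum_series D $ k" for k
    using card_dsum_index[of D k] finite_subset[OF _ finite_atLeastAtMost, of _ 1 n] by blast+
  have "hilbert_series V = dsum_series D
      \<longleftrightarrow> (\<forall>k. hilbert_fun V k = card {x \<in> dsum_index D. index_deg D x = k})"
    by (simp add: fps_eq_iff hilbert_series_def flip: D(2))
  moreover have "(\<exists>\<phi>. graded_iso V D \<phi>)
      \<longleftrightarrow> (\<forall>k. hilbert_fun V k = card {x \<in> dsum_index D. index_deg D x = k})"
    using graded_iso_exists[OF V D(1) _ finite_leads_deg[OF V]]
      hilbert_fun_if_graded_iso[OF _ _ D(1)] V graded_subspace_def by blast
  ultimately show ?thesis using True by (simp add: hilbert_decomp_def)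
qed (auto simp: hilbert_decomp_def)

section \<open>Uliczka's criterion\<close>

lemma nonneg_fps_hilbert_series: "nonneg_fps (hilbert_series V)"
  by (simp add: nonneg_fps_def hilbert_series_def)

lemma nonneg_fps_sum_list: "(\<And>x. x \<in> set xs \<Longrightarrow> nonneg_fps (f x)) \<Longrightarrow> nonneg_fps (\<Sum>x\<leftarrow>xs. f x)"
  by (induction xs) (auto simp: nonneg_fps_def)

text \<open>If all |Z| are at least r, each term survives multiplication by (1-t)^r with a
  nonnegative power of \<open>geom\<close>. Conversely (1-t)^r H has pole order at most n - r;
  decomposing it and giving r more variables to each summand stays within n variables.\<close>

lemma hdepth_eq_Max:
  assumes V: "graded_subspace n V" and ne: "hilbert_series V \<noteq> 0"
    and rat: "(1 - fps_X) ^ n * hilbert_series V = fps_of_poly q"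
  shows "hdepth n V = Max {r. r \<le> n \<and> nonneg_fps ((1 - fps_X) ^ r * hilbert_series V)}"
    (is "_ = Max ?R")
proof -
  have dec: "decomp_hdepth D \<in> ?R" if "hilbert_decomp n V D" for D
  proof -
    have Z: "\<And>Z s. (Z, s) \<in> set D \<Longrightarrow> Z \<subseteq> {1..n}" and H: "hilbert_series V = dsum_series D"
      using that hilbert_decomp_iff[OF V] by auto
    define r where "r = decomp_hdepth D"
    \<comment> \<open>\<open>Min\<close> is meaningful only for a nonempty list; the empty one has
      series 0.\<close>
    have "D \<noteq> []" using H ne by (auto simp: dsum_series_def)
    then have "r \<in> (\<lambda>(Z, s). card Z) ` set D"
      unfolding r_def decomp_hdepth_def by (intro Min_in) auto
    then have "r \<le> n" using Z card_mono[of "{1..n}"] by fastforce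
    moreover have r: "r \<le> card Z" if "(Z, s) \<in> set D" for Z s
      unfolding r_def decomp_hdepth_def using that by (intro Min_le) force+
    have "(1 - fps_X) ^ r * dsum_series D = (\<Sum>(Z, s)\<leftarrow>D. fps_X ^ s * geom ^ (card Z - r))"
      unfolding dsum_series_def sum_list_const_mult[symmetric]
    proof (intro arg_cong[where f = sum_list] map_cong refl)
      fix x assume "x \<in> set D"
      then have "geom ^ card (fst x) = geom ^ r * geom ^ (card (fst x) - r)"
        using r[of "fst x" "snd x"] by (simp flip: power_add)
      then have "(1 - fps_X) ^ r * (fps_X ^ snd x * geom ^ card (fst x))
          = (1 - fps_X) ^ r * geom ^ r * (fps_X ^ snd x * geom ^ (card (fst x) - r))"
        by (simp add: mult_ac)
      then show "(1 - fps_X) ^ r * (case x of (Z, s) \<Rightarrow> fps_X ^ s * geom ^ card Z)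
          = (case x of (Z, s) \<Rightarrow> fps_X ^ s * geom ^ (card Z - r))"
        by (simp add: split_beta one_minus_X_power_geom)
    qed
    moreover have "nonneg_fps (\<Sum>(Z, s)\<leftarrow>D. fps_X ^ s * geom ^ (card Z - r))"
      by (intro nonneg_fps_sum_list) (auto intro!: nonneg_fps_intros)
    ultimately show ?thesis by (simp add: H r_def)
  qed
  \<comment> \<open>Only an inequality: no summand with c = 0 need occur. At the maximal r it
    becomes an equality.\<close>
  have ex: "\<exists>D. hilbert_decomp n V D \<and> r \<le> decomp_hdepth D" if r: "r \<in> ?R" for r
  proof -
    have "(1 - fps_X) ^ (n - r) * ((1 - fps_X) ^ r * hilbert_series V) = fps_of_poly q"
      using r rat by (simp flip: mult.assoc power_add)
    then obtain l where l: "\<forall>(c, s)\<in>set l. c \<le> n - r"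
      "(1 - fps_X) ^ r * hilbert_series V = (\<Sum>(c, s)\<leftarrow>l. fps_X ^ s * geom ^ c)"
      using nonneg_rational_fps_decomp r by blast
    \<comment> \<open>Only the size of Z enters the series, so an initial segment serves.\<close>
    define D where "D = map (\<lambda>(c, s). ({1..c + r}, s)) l"
    have "hilbert_series V = (1 - fps_X) ^ r * geom ^ r * hilbert_series V"
      by (simp add: one_minus_X_power_geom)
    also have "\<dots> = geom ^ r * (\<Sum>(c, s)\<leftarrow>l. fps_X ^ s * geom ^ c)"
      unfolding l(2)[symmetric] by (simp add: mult_ac)
    also have "\<dots> = dsum_series D"
      by (simp add: dsum_series_def D_def o_def split_beta sum_list_const_mult[symmetric] power_add mult_ac)
    finally have H: "hilbert_series V = dsum_series D" .
    moreover have "\<forall>(Z, s)\<in>set D. Z \<subseteq> {1..n}"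
      using l(1) r by (fastforce simp: D_def)
    ultimately have "hilbert_decomp n V D" using hilbert_decomp_iff[OF V] by blast
    moreover have "D \<noteq> []" using H ne by (auto simp: dsum_series_def)
    then have "r \<le> decomp_hdepth D"
      unfolding decomp_hdepth_def by (intro Min.boundedI) (auto simp: D_def)
    ultimately show ?thesis by blast
  qed
  have "finite ?R" by simp
  have 0: "0 \<in> ?R" by (simp add: nonneg_fps_hilbert_series)
  let ?S = "{decomp_hdepth D | D. hilbert_decomp n V D}"
  have sub: "?S \<subseteq> ?R" using dec by blast
  obtain D where "hilbert_decomp n V D" "Max ?R \<le> decomp_hdepth D"
    using ex[of "Max ?R"] Max_in[OF \<open>finite ?R\<close>] 0 by blast
  then have D: "decomp_hdepth D \<in> ?S" "Max ?R \<le> decomp_hdepth D" by blast+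
  have "finite ?S" using sub \<open>finite ?R\<close> by (rule finite_subset)
  then have "Max ?R \<le> Max ?S" using D Max_ge order_trans by blast
  moreover have "Max ?S \<le> Max ?R" using sub D(1) \<open>finite ?R\<close> by (intro Max_mono) blast+
  ultimately have "Max ?S = Max ?R" by simp
  then show ?thesis by (simp add: hdepth_def)
qed

subsection \<open>Monomial ideals and initial ideals\<close>

lemma PR_simps [simp]:
  "carrier (PR n) = polys {1..n}" "f \<otimes>\<^bsub>PR n\<^esub> g = f * g" "\<one>\<^bsub>PR n\<^esub> = 1" "\<zero>\<^bsub>PR n\<^esub> = 0" "f \<oplus>\<^bsub>PR n\<^esub> g = f + g"
  by (simp_all add: PR_def)

lemma mono_pol_nonzero [simp]: "(mono_pol u :: 'k::field mpol) \<noteq> 0"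
  by (metis lookup_single_eq lookup_zero zero_neq_one)

lemma PR_a_inv: "f \<in> polys {1..n} \<Longrightarrow> \<ominus>\<^bsub>PR n\<^esub> f = - f" for f :: "'k::field mpol"
proof -
  interpret R: cring "PR n :: 'k mpol ring" by (rule cring_PR)
  assume f: "f \<in> polys {1..n}"
  then have "- f \<in> polys {1..n}" by (simp add: polys_def)
  with f show ?thesis by (intro R.minus_equality) auto
qed

definition multiples :: "nat \<Rightarrow> mon set \<Rightarrow> mon set" where
  "multiples n M = {u \<in> mons {1..n}. \<exists>v\<in>M. \<exists>w. u = v + w}"

text \<open>Exponents add under multiplication, so the right side is an ideal; conversely each term
  of f is a multiple of a generator. Monomial ideals can thus be handled as sets of
  exponents.\<close>

lemma mon_gen_eq:
  assumes M: "M \<subseteq> mons {1..n}"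
  shows "mon_gen n M = {f :: 'k::field mpol. keys f \<subseteq> multiples n M}" (is "_ = ?J")
proof -
  interpret R: cring "PR n :: 'k mpol ring" by (rule cring_PR)
  have J: "ideal ?J (PR n)"
  proof (rule idealI)
    show "ring (PR n :: 'k mpol ring)" by (rule R.ring_axioms)
    have J_polys: "?J \<subseteq> polys {1..n}" by (auto simp: polys_def multiples_def)
    show "subgroup ?J (add_monoid (PR n))"
    proof
      show "?J \<subseteq> carrier (add_monoid (PR n))" using J_polys by simp
      show "f \<otimes>\<^bsub>add_monoid (PR n)\<^esub> g \<in> ?J" if "f \<in> ?J" "g \<in> ?J" for f g
        using that Poly_Mapping.keys_add[of f g] by auto
      show "\<one>\<^bsub>add_monoid (PR n)\<^esub> \<in> ?J" by simp
      show "inv\<^bsub>add_monoid (PR n)\<^esub> f \<in> ?J" if "f \<in> ?J" for f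
        unfolding a_inv_def[symmetric] PR_a_inv[OF subsetD[OF J_polys that]] using that by simp
    qed
    have mult: "g * f \<in> ?J" if f: "f \<in> ?J" and g: "g \<in> polys {1..n}" for f g
    proof -
      have "x + u \<in> multiples n M" if "x \<in> keys g" "u \<in> keys f" for x u
      proof -
        have "u \<in> multiples n M" using f that by auto
        then obtain v w where "v \<in> M" "u = v + w" by (auto simp: multiples_def)
        moreover have "x + u \<in> mons {1..n}"
          using f g that by (auto simp: mons_plus_iff polys_def multiples_def)
        moreover have "x + (v + w) = v + (x + w)" by (simp add: ac_simps)
        ultimately show ?thesis unfolding multiples_def by blast
      qed
      then show ?thesis using keys_mult[of g f] by auto
    qed
    show "g \<otimes>\<^bsub>PR n\<^esub> f \<in> ?J" "f \<otimes>\<^bsub>PR n\<^esub> g \<in> ?J" if "f \<in> ?J" "g \<in> carrier (PR n)" for f g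
      using mult[of f g] that by (simp_all add: mult.commute)
  qed
  have "v \<in> multiples n M" if "v \<in> M" for v
    unfolding multiples_def using that M by (auto intro!: bexI[of _ v] exI[of _ 0])
  then have "mono_pol ` M \<subseteq> ?J" by auto
  then have "mon_gen n M \<subseteq> ?J"
    unfolding mon_gen_def using J by (intro R.genideal_minimal)
  moreover have "?J \<subseteq> mon_gen n M"
  proof
    fix f assume f: "f \<in> ?J"
    have MR: "mono_pol ` M \<subseteq> carrier (PR n :: 'k mpol ring)" using M by (auto simp: polys_def)
    interpret I: ideal "mon_gen n M :: 'k mpol set" "PR n"
      unfolding mon_gen_def using MR by (rule R.genideal_ideal)
    have single_in: "single u c \<in> mon_gen n M" if "u \<in> keys f" for u and c :: 'k
    proof -
      have "u \<in> multiples n M" using f that by auto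
      then obtain v w where vw: "v \<in> M" "u = v + w" "w \<in> mons {1..n}"
        by (auto simp: multiples_def mons_plus_iff)
      have "(mono_pol v :: 'k mpol) \<in> mon_gen n M"
        unfolding mon_gen_def using R.genideal_self[OF MR] vw(1) by auto
      then have "single w c * mono_pol v \<in> mon_gen n M"
        using I.I_l_closed[of "mono_pol v" "single w c"] vw(3) by (simp add: polys_def)
      then show ?thesis by (simp add: mult_single vw(2) add.commute)
    qed
    have "(\<Sum>u\<in>A. single u (lookup f u)) \<in> mon_gen n M" if "A \<subseteq> keys f" "finite A" for A
      using that(2,1)
    proof (induction A rule: finite_induct)
      case empty
      then show ?case using additive_subgroup.zero_closed[OF I.is_additive_subgroup] by simp
    next
      case (insert u A)
      then show ?case
        using single_in additive_subgroup.a_closed[OF I.is_additive_subgroup, of "single u (lookup f u)" "\<Sum>u\<in>A. single u (lookup f u)"] by simp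
    qed
    moreover have "(\<Sum>u\<in>keys f. single u (lookup f u)) = f"
      by (intro poly_mapping_eqI) (auto simp: lookup_sum lookup_single when_def in_keys_iff)
    ultimately show "f \<in> mon_gen n M" by (metis finite_keys order_refl)
  qed
  ultimately show ?thesis by blast
qed

lemma mono_pol_in_mon_gen_iff:
  "M \<subseteq> mons {1..n} \<Longrightarrow> (mono_pol u :: 'k::field mpol) \<in> mon_gen n M \<longleftrightarrow> u \<in> multiples n M"
  by (simp add: mon_gen_eq)

lemma leads_mon_gen:
  assumes M: "M \<subseteq> mons {1..n}"
  shows "leads (mon_gen n M :: 'k::field mpol set) = multiples n M"
proof (intro equalityI subsetI)
  fix u assume "u \<in> multiples n M"
  then have "(mono_pol u :: 'k mpol) \<in> mon_gen n M - {0}"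
    using mono_pol_in_mon_gen_iff[OF M, of u] by auto
  moreover have "lex_lead (mono_pol u :: 'k mpol) = u" by (intro lex_leadI) auto
  ultimately show "u \<in> leads (mon_gen n M :: 'k mpol set)" unfolding leads_def by (metis imageI)
qed (use lex_lead_in_keys in \<open>auto simp: leads_def mon_gen_eq[OF M]\<close>)

lemma graded_subspace_mon_gen:
  assumes M: "M \<subseteq> mons {1..n}"
  shows "graded_subspace n (mon_gen n M :: 'k::field mpol set)"
  unfolding graded_subspace_def mpol_vs.subspace_def mon_gen_eq[OF M]
proof (intro conjI ballI allI subsetI)
  show "f + g \<in> {f. keys f \<subseteq> multiples n M}"
    if "f \<in> {f. keys f \<subseteq> multiples n M}" "g \<in> {f. keys f \<subseteq> multiples n M}" for f g :: "'k mpol"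
    using that Poly_Mapping.keys_add[of f g] by auto
  show "cscale c f \<in> {f. keys f \<subseteq> multiples n M}" if "f \<in> {f. keys f \<subseteq> multiples n M}" for c and f :: "'k mpol"
    using that by (auto simp: in_keys_iff)
qed (auto simp: keys_hcomp polys_def multiples_def)

lemma graded_subspace_if_graded_ideal:
  assumes "graded_ideal n I"
  shows "graded_subspace n (I :: 'k::field mpol set)"
proof -
  interpret ideal I "PR n" using assms by (simp add: graded_ideal_def)
  have sub: "I \<subseteq> polys {1..n}" using a_subset by simp
  have "cscale c f \<in> I" if "f \<in> I" for c f
    using I_l_closed[OF that, of "single 0 c"] by (simp add: cscale_def polys_def mons_def)
  then have "mpol_vs.subspace I"
    using additive_subgroup.zero_closed[OF is_additive_subgroup]
      additive_subgroup.a_closed[OF is_additive_subgroup]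
    by (auto simp: mpol_vs.subspace_def)
  then show ?thesis using sub assms by (simp add: graded_subspace_def graded_ideal_def)
qed

lemma leads_subset_mons: "graded_subspace n V \<Longrightarrow> leads V \<subseteq> mons {1..n}"
  using lex_lead_in_keys by (fastforce simp: leads_def graded_subspace_def polys_def)

lemma lex_initial_ideal_eq: "lex_initial_ideal n I = mon_gen n (leads I)" for I :: "'k::field mpol set"
proof -
  have "{mono_pol (lex_lead f) :: 'k mpol | f. f \<in> I \<and> f \<noteq> 0} = mono_pol ` leads I"
    by (auto simp: leads_def)
  then show ?thesis by (simp add: lex_initial_ideal_def mon_gen_def)
qed

text \<open>The order is compatible with addition of exponents, so multiplying f by a monomial
  shifts its leading monomial.\<close>

lemma multiples_leads:
  assumes I: "graded_ideal n (I :: 'k::field mpol set)"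
  shows "multiples n (leads I) = leads I"
proof (intro equalityI subsetI)
  interpret ideal I "PR n" using I by (simp add: graded_ideal_def)
  fix u assume "u \<in> multiples n (leads I)"
  then obtain v w where v: "v \<in> leads I" and vw: "u = v + w" and w: "w \<in> mons {1..n}"
    by (auto simp: multiples_def mons_plus_iff)
  then obtain f where f: "f \<in> I" "f \<noteq> 0" and u: "u = lex_lead f + w" by (auto simp: leads_def)
  have "mono_pol w * f \<in> I"
    using I_l_closed[OF f(1), of "mono_pol w"] w by (simp add: polys_def)
  moreover have u_in: "u \<in> keys (mono_pol w * f)"
    using lex_lead_in_keys[OF f(2)] by (simp add: keys_mono_pol_mult u add.commute)
  moreover have "lex_lead (mono_pol w * f) = u"
    using u_in by (intro lex_leadI) (auto simp: keys_mono_pol_mult u add.commute[of _ w] intro: add_left_mono lex_lead_ge)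
  ultimately show "u \<in> leads I"
    unfolding leads_def by (intro image_eqI[of _ _ "mono_pol w * f"]) auto
next
  fix u assume u: "u \<in> leads I"
  then have "u \<in> mons {1..n}"
    using leads_subset_mons[OF graded_subspace_if_graded_ideal[OF I]] by auto
  then show "u \<in> multiples n (leads I)"
    using u unfolding multiples_def by (auto intro!: bexI[of _ u] exI[of _ 0])
qed

text \<open>The monomials of the initial ideal are exactly the leading monomials of
  \<open>I\<close>, so both sides count the same set.\<close>

lemma hilbert_fun_lex_initial_ideal:
  assumes I: "graded_ideal n (I :: 'k::field mpol set)"
  shows "hilbert_fun (lex_initial_ideal n I) k = hilbert_fun I k"
proof -
  have sub: "graded_subspace n I" using I by (rule graded_subspace_if_graded_ideal)
  note leads = leads_subset_mons[OF sub]
  show ?thesis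
    unfolding lex_initial_ideal_eq hilbert_fun_eq_card_leads[OF sub]
      hilbert_fun_eq_card_leads[OF graded_subspace_mon_gen[OF leads]]
      leads_mon_gen[OF leads] multiples_leads[OF I] ..
qed

subsection \<open>Monomials as sorted lists of variables\<close>

text \<open>Inverse to \<open>var_list\<close> on sorted lists.\<close>

definition mon_of :: "nat list \<Rightarrow> mon" where
  "mon_of xs = (\<Sum>i\<leftarrow>xs. single i 1)"

lemma mon_of_Nil [simp]: "mon_of [] = 0"
  by (simp add: mon_of_def)

lemma mon_of_Cons [simp]: "mon_of (x # xs) = single x 1 + mon_of xs"
  by (simp add: mon_of_def)

lemma mon_of_append: "mon_of (xs @ ys) = mon_of xs + mon_of ys"
  by (simp add: mon_of_def)

lemma lookup_mon_of: "lookup (mon_of xs) i = count (mset xs) i"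
  by (induction xs) (auto simp: lookup_add lookup_single when_def)

lemma keys_mon_of [simp]: "keys (mon_of xs) = set xs"
  by (auto simp: in_keys_iff lookup_mon_of)

lemma mdeg_mon_of [simp]: "mdeg (mon_of xs) = length xs"
  by (induction xs) (auto simp: mdeg_plus)

lemma sorted_concat_replicate: "sorted ks \<Longrightarrow> sorted (concat (map (\<lambda>i. replicate (f i) i) ks))"
  by (induction ks) (auto simp: sorted_append)

lemma count_concat_replicate:
  "distinct ks \<Longrightarrow> count (mset (concat (map (\<lambda>i. replicate (f i) i) ks))) j = (if j \<in> set ks then f j else 0)"
  by (induction ks) auto

lemma sorted_var_list [simp]: "sorted (var_list u)"
  unfolding var_list_def by (intro sorted_concat_replicate) simp

lemma count_var_list: "count (mset (var_list u)) i = lookup u i"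
  unfolding var_list_def by (subst count_concat_replicate) (auto simp: in_keys_iff)

lemma mon_of_var_list [simp]: "mon_of (var_list u) = u"
  by (intro poly_mapping_eqI) (simp add: lookup_mon_of count_var_list)

lemma set_var_list [simp]: "set (var_list u) = keys u"
  using keys_mon_of[of "var_list u"] by simp

lemma length_var_list [simp]: "length (var_list u) = mdeg u"
  using mdeg_mon_of[of "var_list u"] by simp

lemma sorted_eqI_mset: "sorted xs \<Longrightarrow> sorted ys \<Longrightarrow> mset xs = mset ys \<Longrightarrow> xs = ys"
  by (metis properties_for_sort sorted_sort_id)

lemma var_list_mon_of: "sorted xs \<Longrightarrow> var_list (mon_of xs) = xs"
  by (intro sorted_eqI_mset) (auto simp: multiset_eq_iff count_var_list lookup_mon_of)

lemma var_list_eq_Nil_iff [simp]: "var_list u = [] \<longleftrightarrow> u = 0"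
  by (metis mon_of_Nil mon_of_var_list var_list_mon_of sorted_simps(1))

lemma max_var_in_keys: "u \<noteq> 0 \<Longrightarrow> max_var u \<in> keys u"
  unfolding max_var_def by (metis last_in_set set_var_list var_list_eq_Nil_iff)

lemma sorted_le_last: "sorted xs \<Longrightarrow> x \<in> set xs \<Longrightarrow> x \<le> last xs"
  by (induction xs) auto

lemma max_var_ge: "i \<in> keys u \<Longrightarrow> i \<le> max_var u"
  unfolding max_var_def by (intro sorted_le_last) auto

text \<open>Variables of smaller index are larger, so the order reverses: at the first difference x
  < y, and no later letter of the second word can be x.\<close>

lemma mon_of_mono:
  "list_all2 (\<le>) xs ys \<Longrightarrow> sorted xs \<Longrightarrow> sorted ys \<Longrightarrow> mon_of ys \<le> mon_of xs"
proof (induction xs ys rule: list_all2_induct)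
  case Nil
  show ?case by simp
next
  case (Cons x xs y ys)
  show ?case
  proof (cases "x = y")
    case True
    then show ?thesis using Cons by (simp add: add_left_mono)
  next
    case False
    with Cons.hyps have "x < y" by simp
    then have y: "count (mset (y # ys)) k = 0" if "k \<le> x" for k
      using that Cons.prems(2) by (fastforce simp: count_eq_zero_iff)
    have "mon_of (y # ys) < mon_of (x # xs)"
      unfolding less_poly_mapping.rep_eq less_fun_def lookup_mon_of
    proof (intro exI[of _ x] conjI allI impI)
      show "count (mset (y # ys)) x < count (mset (x # xs)) x" using y[of x] by simp
      show "count (mset (y # ys)) k = count (mset (x # xs)) k" if "k < x" for k
        using y[of k] that Cons.prems(1) by (fastforce simp: count_eq_zero_iff)
    qed
    then show ?thesis by simp
  qed
qed

text \<open>Enlarging a multiset can only lower its k-th smallest element. With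
  \<open>mon_of_mono\<close>, the prefix of degree deg g of a multiple of g is lexicographically at
  least g.\<close>

lemma sorted_submset_list_all2:
  "sorted xs \<Longrightarrow> sorted ys \<Longrightarrow> mset ys \<subseteq># mset xs
    \<Longrightarrow> length ys \<le> length xs \<and> list_all2 (\<le>) (take (length ys) xs) ys"
proof (induction ys arbitrary: xs)
  case Nil
  then show ?case by simp
next
  case (Cons y ys)
  have "y \<in> set xs" using Cons.prems(3) by (metis list.set_intros(1) mset_subset_eqD set_mset_mset)
  then obtain x xs' where xs: "xs = x # xs'" by (cases xs) auto
  have xy: "x \<le> y" using \<open>y \<in> set xs\<close> Cons.prems(1) xs by auto
  have "mset ys \<subseteq># mset xs'"
  proof (cases "x = y")
    case True
    then show ?thesis using Cons.prems(3) xs by simp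
  next
    case False
    with xy have "x \<notin> set (y # ys)" using Cons.prems(2) by auto
    show ?thesis
    proof (rule mset_subset_eqI)
      fix a
      have "count (mset (y # ys)) a \<le> count (mset xs) a"
        using Cons.prems(3) by (rule mset_subset_eq_count)
      then show "count (mset ys) a \<le> count (mset xs') a"
        using xs \<open>x \<notin> set (y # ys)\<close> by (cases "a = x") (auto simp: count_eq_zero_iff[THEN iffD2] split: if_splits)
    qed
  qed
  then show ?case using Cons.IH[of xs'] Cons.prems xs xy by simp
qed

lemma mset_var_list_subset_iff: "mset (var_list u) \<subseteq># mset (var_list v) \<longleftrightarrow> (\<exists>w. v = u + w)"
proof
  assume sub: "mset (var_list u) \<subseteq># mset (var_list v)"
  have "v = u + (v - u)"
    using mset_subset_eq_count[OF sub] by (intro poly_mapping_eqI) (simp add: lookup_add lookup_minus count_var_list)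
  then show "\<exists>w. v = u + w" ..
qed (auto simp: subseteq_mset_def count_var_list lookup_add)

text \<open>Links words to Stanley cells: v/u may use only variables from the last one of u
  on.\<close>

lemma var_list_prefix_iff:
  "(\<exists>c. var_list u = take c (var_list v)) \<longleftrightarrow> (\<exists>w. v = u + w \<and> (\<forall>i\<in>keys u. \<forall>j\<in>keys w. i \<le> j))"
proof
  assume "\<exists>c. var_list u = take c (var_list v)"
  then obtain c where c: "var_list u = take c (var_list v)" ..
  have "v = mon_of (take c (var_list v) @ drop c (var_list v))" by simp
  then have "v = u + mon_of (drop c (var_list v))" unfolding mon_of_append by (simp flip: c)
  moreover have "sorted (take c (var_list v) @ drop c (var_list v))" by simp
  then have "\<forall>i\<in>keys u. \<forall>j\<in>set (drop c (var_list v)). i \<le> j"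
    unfolding sorted_append by (simp flip: c)
  ultimately show "\<exists>w. v = u + w \<and> (\<forall>i\<in>keys u. \<forall>j\<in>keys w. i \<le> j)"
    by (intro exI[of _ "mon_of (drop c (var_list v))"]) simp
next
  assume "\<exists>w. v = u + w \<and> (\<forall>i\<in>keys u. \<forall>j\<in>keys w. i \<le> j)"
  then obtain w where w: "v = u + w" "\<forall>i\<in>keys u. \<forall>j\<in>keys w. i \<le> j" by blast
  then have "var_list v = var_list u @ var_list w"
    by (intro sorted_eqI_mset) (auto simp: sorted_append multiset_eq_iff count_var_list lookup_add)
  then show "\<exists>c. var_list u = take c (var_list v)" by (intro exI[of _ "mdeg u"]) simp
qed

subsection \<open>Stanley decompositions of lex ideals\<close>

text \<open>The minimal generators of a proper lex ideal, described by exponents alone so that the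
  combinatorics involves no polynomials.\<close>

definition lex_gens :: "nat \<Rightarrow> mon set \<Rightarrow> bool" where
  "lex_gens n G \<longleftrightarrow> finite G \<and> G \<subseteq> mons {1..n} \<and> 0 \<notin> G \<and> (\<forall>g\<in>G. \<forall>h\<in>G. \<forall>w. h = g + w \<longrightarrow> h = g) \<and>
     (\<forall>u\<in>multiples n G. \<forall>v\<in>mons {1..n}. mdeg v = mdeg u \<longrightarrow> u < v \<longrightarrow> v \<in> multiples n G)"

lemma multiples_refl: "g \<in> G \<Longrightarrow> G \<subseteq> mons {1..n} \<Longrightarrow> g \<in> multiples n G"
  unfolding multiples_def by (auto intro!: bexI[of _ g] exI[of _ 0])

text \<open>Of two prefixes of one word one is a prefix of the other, hence divides it.\<close>

lemma lex_gens_prefix_unique: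
  assumes G: "lex_gens n G" and g: "g \<in> G" "var_list g = take b xs" and h: "h \<in> G" "var_list h = take c xs"
  shows "g = h"
proof -
  have *: "g = h" if g: "g \<in> G" "var_list g = take b xs" and h: "h \<in> G" "var_list h = take c xs"
    and "b \<le> c" for g h b c
  proof -
    have "var_list g = take b (var_list h)" using that by simp
    then obtain w where "h = g + w" using var_list_prefix_iff by blast
    moreover have "\<forall>w. h = g + w \<longrightarrow> h = g" using G g(1) h(1) by (simp add: lex_gens_def)
    ultimately show ?thesis by simp
  qed
  show ?thesis
  proof (cases "b \<le> c")
    case True
    then show ?thesis by (rule *[OF g h])
  next
    case False
    then show ?thesis using *[OF h g] by simp
  qed
qed

text \<open>The shortest prefix of \<open>v\<close> lying in the ideal is a generator: a proper divisor \<open>g\<close> of it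
  is lexicographically at most the prefix of the same degree.\<close>

lemma lex_gens_prefix_exists:
  assumes G: "lex_gens n G" and v: "v \<in> multiples n G"
  shows "\<exists>g\<in>G. \<exists>c. var_list g = take c (var_list v)"
proof -
  define P where "P c \<longleftrightarrow> mon_of (take c (var_list v)) \<in> multiples n G" for c
  define c where "c = (LEAST c. P c)"
  have len: "P (mdeg v)" using v by (simp add: P_def)
  then have Pc: "P c" unfolding c_def by (rule LeastI)
  have c_le: "c \<le> mdeg v" unfolding c_def using len by (rule Least_le)
  define xs where "xs = take c (var_list v)"
  have sorted: "sorted xs" by (simp add: xs_def sorted_wrt_take)
  have "mon_of xs \<in> multiples n G" using Pc by (simp add: P_def xs_def)
  then obtain g w where gw: "g \<in> G" "mon_of xs = g + w" by (auto simp: multiples_def)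
  define e where "e = mdeg g"
  have "mset (var_list g) \<subseteq># mset (var_list (mon_of xs))"
    using gw(2) mset_var_list_subset_iff by blast
  then have sub: "mset (var_list g) \<subseteq># mset xs" by (simp add: var_list_mon_of[OF sorted])
  have le: "e \<le> length xs" "list_all2 (\<le>) (take e xs) (var_list g)"
    using sorted_submset_list_all2[OF sorted _ sub] by (auto simp: e_def)
  have "e = c"
  proof (rule ccontr)
    assume "e \<noteq> c"
    then have "e < c" using le(1) c_le by (simp add: xs_def)
    have take_e: "take e xs = take e (var_list v)" using \<open>e < c\<close> by (simp add: xs_def)
    have "g \<le> mon_of (take e xs)"
      using mon_of_mono[OF le(2)] sorted by (simp add: sorted_wrt_take)
    moreover have "set (take e xs) \<subseteq> keys v"
      using set_take_subset[of e "var_list v"] take_e by simp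
    then have "mon_of (take e xs) \<in> mons {1..n}"
      using v by (auto simp: multiples_def mons_def)
    moreover have "mdeg (mon_of (take e xs)) = mdeg g" using le(1) by (simp add: e_def)
    moreover have "g \<in> multiples n G" using gw(1) G by (intro multiples_refl) (simp_all add: lex_gens_def)
    ultimately have "mon_of (take e xs) \<in> multiples n G"
      using G unfolding lex_gens_def by (metis order_le_less)
    then have "P e" by (simp add: P_def take_e)
    then show False using \<open>e < c\<close> not_less_Least unfolding c_def by blast
  qed
  then have "mdeg (mon_of xs) = mdeg g" using c_le by (simp add: e_def xs_def)
  then have "w = 0" using gw(2) by (simp add: mdeg_plus mdeg_eq_0_iff)
  then have "var_list g = take c (var_list v)"
    using gw(2) var_list_mon_of[OF sorted] by (simp add: xs_def)
  then show ?thesis using gw(1) by blast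
qed

text \<open>General shifts \<open>f g\<close> and variable sets \<open>Z g\<close> let this serve
  both decompositions, with shift g for L and \<open>sq_op g\<close> for L\<sigma>.\<close>

lemma card_disjoint_translates:
  assumes G: "finite G" and Z: "\<And>g. g \<in> G \<Longrightarrow> finite (Z g)"
    and T: "T = (\<Union>g\<in>G. (+) (f g) ` mons (Z g))"
    and disj: "\<And>g h. g \<in> G \<Longrightarrow> h \<in> G \<Longrightarrow> g \<noteq> h \<Longrightarrow> (+) (f g) ` mons (Z g) \<inter> (+) (f h) ` mons (Z h) = {}"
  shows "int (card {u \<in> T. mdeg u = k}) = (\<Sum>g\<in>G. fps_X ^ mdeg (f g) * geom ^ card (Z g)) $ k"
proof -
  define A where "A g = {u \<in> (+) (f g) ` mons (Z g). mdeg u = k}" for g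
  have A: "finite (A g) \<and> int (card (A g)) = (fps_X ^ mdeg (f g) * geom ^ card (Z g)) $ k" if "g \<in> G" for g
  proof (cases "mdeg (f g) \<le> k")
    case True
    have "A g = (+) (f g) ` mons_deg (Z g) (k - mdeg (f g))"
      using True by (auto simp: A_def mons_deg_def mdeg_plus)
    moreover have "inj_on ((+) (f g)) (mons_deg (Z g) (k - mdeg (f g)))" by (rule inj_onI) simp
    ultimately show ?thesis
      using card_mons_deg[OF Z[OF that]] True by (simp add: card_image fps_X_power_mult_nth)
  next
    case False
    then have "A g = {}" by (auto simp: A_def mdeg_plus)
    then show ?thesis using False by (simp add: fps_X_power_mult_nth)
  qed
  have "{u \<in> T. mdeg u = k} = (\<Union>g\<in>G. A g)" by (auto simp: T A_def)
  moreover have "A g \<inter> A h = {}" if "g \<in> G" "h \<in> G" "g \<noteq> h" for g h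
    using disj[OF that] by (auto simp: A_def)
  then have "card (\<Union>g\<in>G. A g) = (\<Sum>g\<in>G. card (A g))"
    using G A by (intro card_UN_disjoint) auto
  ultimately show ?thesis using A by (simp add: fps_sum_nth)
qed

lemma lex_gens_multiples_eq:
  assumes G: "lex_gens n G"
  shows "multiples n G = (\<Union>g\<in>G. (+) g ` mons {max_var g..n})"
    and "\<And>g h. g \<in> G \<Longrightarrow> h \<in> G \<Longrightarrow> g \<noteq> h \<Longrightarrow> (+) g ` mons {max_var g..n} \<inter> (+) h ` mons {max_var h..n} = {}"
proof -
  have prefix: "\<exists>c. var_list g = take c (var_list (g + w))" if "g \<in> G" "w \<in> mons {max_var g..n}" for g w
  proof -
    have "\<forall>i\<in>keys g. \<forall>j\<in>keys w. i \<le> j"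
      using that max_var_ge[of _ g] by (fastforce simp: mons_def)
    then show ?thesis by (subst var_list_prefix_iff) blast
  qed
  show "multiples n G = (\<Union>g\<in>G. (+) g ` mons {max_var g..n})"
  proof (intro equalityI subsetI)
    fix v assume v: "v \<in> multiples n G"
    then obtain g c where g: "g \<in> G" "var_list g = take c (var_list v)"
      using lex_gens_prefix_exists[OF G] by blast
    then obtain w where w: "v = g + w" "\<forall>i\<in>keys g. \<forall>j\<in>keys w. i \<le> j"
      using var_list_prefix_iff by blast
    have "g \<noteq> 0" using G g(1) by (auto simp: lex_gens_def)
    then have "w \<in> mons {max_var g..n}"
      using w v max_var_in_keys[of g] by (auto simp: mons_def multiples_def keys_plus_nat)
    then show "v \<in> (\<Union>g\<in>G. (+) g ` mons {max_var g..n})" using g(1) w(1) by blast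
  next
    fix v assume "v \<in> (\<Union>g\<in>G. (+) g ` mons {max_var g..n})"
    then obtain g w where gw: "g \<in> G" "w \<in> mons {max_var g..n}" "v = g + w" by auto
    have "g \<noteq> 0" "g \<in> mons {1..n}" using G gw(1) by (auto simp: lex_gens_def)
    \<comment> \<open>All natural numbers index variables, so index 0 has to be kept out of the
      cell.\<close>
    then have "max_var g \<ge> 1" using max_var_in_keys[of g] by (auto simp: mons_def)
    then have "w \<in> mons {1..n}" using gw(2) by (auto simp: mons_def)
    then show "v \<in> multiples n G"
      using gw \<open>g \<in> mons {1..n}\<close> by (auto simp: multiples_def mons_plus_iff)
  qed
  show "(+) g ` mons {max_var g..n} \<inter> (+) h ` mons {max_var h..n} = {}" if "g \<in> G" "h \<in> G" "g \<noteq> h" for g h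
  proof (rule ccontr)
    note gh = that
    assume "(+) g ` mons {max_var g..n} \<inter> (+) h ` mons {max_var h..n} \<noteq> {}"
    then obtain w w' where w: "w \<in> mons {max_var g..n}" "w' \<in> mons {max_var h..n}" "g + w = h + w'" by auto
    obtain b c where "var_list g = take b (var_list (g + w))" "var_list h = take c (var_list (g + w))"
      using prefix[OF gh(1) w(1)] prefix[OF gh(2) w(2)] w(3) by auto
    then show False using lex_gens_prefix_unique[OF G] gh by blast
  qed
qed

lemma hilbert_series_mon_gen:
  assumes M: "M \<subseteq> mons {1..n}" and G: "finite G" and Z: "\<And>g. g \<in> G \<Longrightarrow> finite (Z g)"
    and T: "multiples n M = (\<Union>g\<in>G. (+) (f g) ` mons (Z g))"
    and disj: "\<And>g h. g \<in> G \<Longrightarrow> h \<in> G \<Longrightarrow> g \<noteq> h \<Longrightarrow> (+) (f g) ` mons (Z g) \<inter> (+) (f h) ` mons (Z h) = {}"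
  shows "hilbert_series (mon_gen n M :: 'k::field mpol set) = (\<Sum>g\<in>G. fps_X ^ mdeg (f g) * geom ^ card (Z g))"
  using card_disjoint_translates[OF G Z T disj]
  by (intro fps_ext)
    (simp add: hilbert_series_def hilbert_fun_eq_card_leads[OF graded_subspace_mon_gen[OF M]] leads_mon_gen[OF M])

lemma hilbert_series_lex:
  assumes G: "lex_gens n G"
  shows "hilbert_series (mon_gen n G :: 'k::field mpol set)
    = (\<Sum>g\<in>G. fps_X ^ mdeg g * geom ^ (Suc n - max_var g))"
proof -
  have "hilbert_series (mon_gen n G :: 'k mpol set) = (\<Sum>g\<in>G. fps_X ^ mdeg g * geom ^ card {max_var g..n})"
    using G lex_gens_multiples_eq[OF G]
    by (intro hilbert_series_mon_gen) (auto simp: lex_gens_def)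
  then show ?thesis by simp
qed

subsection \<open>The squarefree operator\<close>

text \<open>The squarefree operator on words: weakly increasing words become strictly increasing,
  and prefixes are respected.\<close>

definition shift_list :: "nat list \<Rightarrow> nat list" where
  "shift_list xs = map (\<lambda>k. xs ! k + k) [0..<length xs]"

lemma length_shift_list [simp]: "length (shift_list xs) = length xs"
  by (simp add: shift_list_def)

lemma nth_shift_list: "k < length xs \<Longrightarrow> shift_list xs ! k = xs ! k + k"
  by (simp add: shift_list_def)

lemma take_shift_list: "take c (shift_list xs) = shift_list (take c xs)"
  by (intro nth_equalityI) (auto simp: nth_shift_list)

lemma shift_list_inject: "shift_list xs = shift_list ys \<longleftrightarrow> xs = ys"
proof
  assume eq: "shift_list xs = shift_list ys"
  then have len: "length xs = length ys" by (metis length_shift_list)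
  moreover have "xs ! k = ys ! k" if "k < length xs" for k
    using that len arg_cong[OF eq, of "\<lambda>l. l ! k"] by (simp add: nth_shift_list)
  ultimately show "xs = ys" by (intro nth_equalityI)
qed simp

lemma strict_sorted_shift_list: "sorted xs \<Longrightarrow> sorted_wrt (<) (shift_list xs)"
  unfolding sorted_wrt_iff_nth_less[of "(<)"]
  by (auto simp: nth_shift_list intro!: add_le_less_mono sorted_nth_mono)

text \<open>From position i to j a strictly increasing list grows by at least j - i, so subtracting
  positions leaves it weakly increasing. Entries from 1 on make the k-th at least k + 1, so nothing
  truncates.\<close>

lemma strict_sorted_unshift:
  assumes "sorted_wrt (<) fs" "\<And>x. x \<in> set fs \<Longrightarrow> 1 \<le> x"
  obtains ws where "shift_list ws = fs" "sorted ws" "\<And>x. x \<in> set ws \<Longrightarrow> 1 \<le> x"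
proof
  have gap: "fs ! i + (j - i) \<le> fs ! j" if "i \<le> j" "j < length fs" for i j
    using that
  proof (induction j rule: dec_induct)
    case (step j)
    then have "fs ! j < fs ! Suc j" using assms(1) by (simp add: sorted_wrt_iff_nth_less)
    then show ?case using step by simp
  qed simp
  have ge: "k + 1 \<le> fs ! k" if "k < length fs" for k
    using gap[of 0 k] that assms(2)[of "fs ! 0"] by (cases fs) auto
  define ws where "ws = map (\<lambda>k. fs ! k - k) [0..<length fs]"
  have ws: "length ws = length fs" "\<And>k. k < length fs \<Longrightarrow> ws ! k = fs ! k - k" by (simp_all add: ws_def)
  show "shift_list ws = fs"
    using ge by (intro nth_equalityI) (force simp: ws nth_shift_list)+
  show "sorted ws"
    unfolding sorted_iff_nth_mono ws(1)
  proof (intro allI impI)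
    fix i j assume "i \<le> j" "j < length fs"
    then show "ws ! i \<le> ws ! j" using gap[of i j] by (simp add: ws)
  qed
  show "1 \<le> x" if "x \<in> set ws" for x
    using that ge by (force simp: ws_def)
qed

lemma sq_op_eq: "sq_op u = mon_of (shift_list (var_list u))"
  unfolding sq_op_def mon_of_def shift_list_def
  by (simp add: o_def interv_sum_list_conv_sum_set_nat atLeast0LessThan del: length_var_list)

lemma mdeg_sq_op [simp]: "mdeg (sq_op u) = mdeg u"
  by (simp add: sq_op_eq)

lemma keys_sq_op: "keys (sq_op u) = set (shift_list (var_list u))"
  by (simp add: sq_op_eq)

lemma card_keys_sq_op [simp]: "card (keys (sq_op u)) = mdeg u"
  using distinct_card[of "shift_list (var_list u)"] strict_sorted_shift_list[of "var_list u"]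
  by (simp add: keys_sq_op strict_sorted_iff)

lemma lookup_sq_op: "lookup (sq_op u) i = (if i \<in> keys (sq_op u) then 1 else 0)"
  using strict_sorted_shift_list[of "var_list u"]
  by (auto simp: sq_op_eq lookup_mon_of strict_sorted_iff distinct_count_atmost_1)

text \<open>The last letter is the largest and is shifted most, by deg u - 1; hence m is the largest
  variable in any generator of L\<sigma>.\<close>

lemma max_keys_sq_op:
  assumes "u \<noteq> 0"
  shows "max_var u + mdeg u - 1 \<in> keys (sq_op u)" "i \<in> keys (sq_op u) \<Longrightarrow> i \<le> max_var u + mdeg u - 1"
proof -
  have ne: "var_list u \<noteq> []" using assms by simp
  have ne': "shift_list (var_list u) \<noteq> []" using ne by (metis length_0_conv length_shift_list)
  have last: "last (shift_list (var_list u)) = max_var u + mdeg u - 1"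
  proof -
    have "0 < mdeg u" using assms by (simp add: mdeg_eq_0_iff zero_less_iff_neq_zero)
    then show ?thesis using ne ne' by (simp add: last_conv_nth nth_shift_list max_var_def)
  qed
  show "max_var u + mdeg u - 1 \<in> keys (sq_op u)"
    using last_in_set[OF ne'] by (simp add: last keys_sq_op)
  show "i \<le> max_var u + mdeg u - 1" if "i \<in> keys (sq_op u)"
    using sorted_le_last[of "shift_list (var_list u)" i] strict_sorted_shift_list[of "var_list u"] that
    by (simp add: keys_sq_op last strict_sorted_iff)
qed

text \<open>Strict counterpart of \<open>var_list_prefix_iff\<close>, with supports in place of
  monomials.\<close>

lemma sorted_list_of_set_prefix_iff:
  assumes F: "finite F" and qs: "sorted_wrt (<) qs"
  shows "(\<exists>c. qs = take c (sorted_list_of_set F)) \<longleftrightarrow> set qs \<subseteq> F \<and> (\<forall>i\<in>set qs. \<forall>j\<in>F - set qs. i < j)"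
proof
  assume "\<exists>c. qs = take c (sorted_list_of_set F)"
  then obtain c where c: "qs = take c (sorted_list_of_set F)" ..
  define rs where "rs = drop c (sorted_list_of_set F)"
  have eq: "sorted_list_of_set F = qs @ rs" by (simp add: c rs_def)
  then have "sorted_wrt (<) (qs @ rs)" by (metis strict_sorted_list_of_set)
  moreover have "F = set qs \<union> set rs" using F eq by (metis set_append set_sorted_list_of_set)
  ultimately show "set qs \<subseteq> F \<and> (\<forall>i\<in>set qs. \<forall>j\<in>F - set qs. i < j)"
    by (auto simp: sorted_wrt_append)
next
  assume "set qs \<subseteq> F \<and> (\<forall>i\<in>set qs. \<forall>j\<in>F - set qs. i < j)"
  moreover from this have "F = set qs \<union> set (sorted_list_of_set (F - set qs))" using F by auto
  ultimately have "sorted_list_of_set F = qs @ sorted_list_of_set (F - set qs)"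
    using F qs by (intro strict_sorted_equal) (auto simp: sorted_wrt_append)
  then show "\<exists>c. qs = take c (sorted_list_of_set F)" by (intro exI[of _ "length qs"]) simp
qed

text \<open>If \<open>F\<close> contains the support of a generator, then its first elements are the support of
  \<open>v\<^sup>\<sigma>\<close> for a monomial \<open>v\<close> of the same degree which is lexicographically at least as large.\<close>

lemma sq_op_prefix_exists:
  assumes G: "lex_gens n G" and F: "finite F" "0 \<notin> F" and g: "g \<in> G" "keys (sq_op g) \<subseteq> F"
  shows "\<exists>h\<in>G. \<exists>c. shift_list (var_list h) = take c (sorted_list_of_set F)"
proof -
  define qs where "qs = shift_list (var_list g)"
  define fs where "fs = take (mdeg g) (sorted_list_of_set F)"
  have qs: "sorted_wrt (<) qs" unfolding qs_def by (intro strict_sorted_shift_list) simp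
  have "mset qs \<subseteq># mset (sorted_list_of_set F)"
    using qs g(2) F(1) by (intro mset_subset_eqI) (auto simp: strict_sorted_iff distinct_count_atmost_1 qs_def keys_sq_op)
  then have le: "mdeg g \<le> card F" "list_all2 (\<le>) fs qs"
    using sorted_submset_list_all2[of "sorted_list_of_set F" qs] qs F(1)
    by (auto simp: qs_def fs_def strict_sorted_iff)
  have "sorted_wrt (<) fs" unfolding fs_def by (intro sorted_wrt_take) simp
  moreover have "1 \<le> x" if "x \<in> set fs" for x
  proof -
    have "x \<in> F" using that F(1) set_take_subset[of "mdeg g" "sorted_list_of_set F"] by (auto simp: fs_def)
    then show ?thesis using F(2) by (cases x) auto
  qed
  ultimately obtain ws where ws: "shift_list ws = fs" "sorted ws" "\<And>x. x \<in> set ws \<Longrightarrow> 1 \<le> x"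
    using strict_sorted_unshift by metis
  have len: "length ws = mdeg g" using ws(1) le(1) F(1) by (metis fs_def length_shift_list length_sorted_list_of_set length_take min.absorb2)
  have le': "ws ! k \<le> var_list g ! k" if "k < mdeg g" for k
    using list_all2_nthD[OF le(2), of k] that len
    by (simp add: ws(1)[symmetric] qs_def nth_shift_list)
  then have all2: "list_all2 (\<le>) ws (var_list g)"
    by (simp add: list_all2_conv_all_nth len)
  have gm: "g \<in> mons {1..n}" "g \<in> multiples n G"
    using G g(1) multiples_refl[of g G n] by (auto simp: lex_gens_def)
  have "g \<le> mon_of ws" using mon_of_mono[OF all2 ws(2)] by simp
  \<comment> \<open>Entrywise \<open>ws\<close> lies below the word of g, so its monomial still
    belongs to S.\<close>
  moreover have "x \<le> n" if x: "x \<in> set ws" for x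
  proof -
    obtain k where k: "k < mdeg g" "x = ws ! k" using x len by (metis in_set_conv_nth)
    have "var_list g ! k \<in> keys g" using k(1) by (metis length_var_list nth_mem set_var_list)
    then show ?thesis using gm(1) le'[OF k(1)] k(2) by (force simp: mons_def)
  qed
  then have "mon_of ws \<in> mons {1..n}" using ws(3) by (auto simp: mons_def)
  moreover have "mdeg (mon_of ws) = mdeg g" by (simp add: len)
  ultimately have "mon_of ws \<in> multiples n G"
    using G gm(2) unfolding lex_gens_def by (metis order_le_less)
  then obtain h c where h: "h \<in> G" "var_list h = take c ws"
    using lex_gens_prefix_exists[OF G] var_list_mon_of[OF ws(2)] by metis
  \<comment> \<open>The prefix length c may exceed the length of \<open>ws\<close>, hence the
    minimum.\<close>
  have "shift_list (var_list h) = take (min c (mdeg g)) (sorted_list_of_set F)"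
    by (simp add: h(2) ws(1) fs_def flip: take_shift_list)
  then show ?thesis using h(1) by blast
qed

text \<open>\<open>shift_list\<close> is injective and commutes with \<open>take\<close>, so
  uniqueness carries over from the unshifted words.\<close>

lemma sq_op_prefix_unique:
  assumes G: "lex_gens n G"
    and g: "g \<in> G" "shift_list (var_list g) = take b fs"
    and h: "h \<in> G" "shift_list (var_list h) = take c fs"
  shows "g = h"
proof -
  have *: "g = h" if g: "g \<in> G" "shift_list (var_list g) = take b fs"
    and h: "h \<in> G" "shift_list (var_list h) = take c fs" and "b \<le> c" for g h b c
  proof -
    have "shift_list (var_list g) = shift_list (take b (var_list h))"
      using that by (simp flip: take_shift_list)
    then have "var_list g = take b (var_list h)" by (simp add: shift_list_inject)
    then show ?thesis using lex_gens_prefix_unique[OF G g(1), of b "var_list h" h "mdeg h"] h(1) by simp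
  qed
  show ?thesis
  proof (cases "b \<le> c")
    case True
    then show ?thesis by (rule *[OF g h])
  next
    case False
    then show ?thesis using *[OF h g] by simp
  qed
qed

section \<open>The Stanley decomposition of L\<sigma>\<close>

definition sq_max :: "mon \<Rightarrow> nat" where
  "sq_max g = max_var g + mdeg g - 1"

text \<open>An interval in the lattice of subsets. Recording supports lets the same cells count all
  monomials and the squarefree ones.\<close>

definition sq_cell :: "nat \<Rightarrow> mon \<Rightarrow> nat set set" where
  "sq_cell m g = {F. keys (sq_op g) \<subseteq> F \<and> F \<subseteq> keys (sq_op g) \<union> {sq_max g<..m}}"

lemma keys_sq_op_subset:
  assumes "g \<in> mons {1..n}" "g \<noteq> 0" "sq_max g \<le> m"
  shows "keys (sq_op g) \<subseteq> {1..m}"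
proof
  fix i assume i: "i \<in> keys (sq_op g)"
  then obtain k where k: "k < mdeg g" "i = var_list g ! k + k"
    by (auto simp: keys_sq_op in_set_conv_nth nth_shift_list)
  have "var_list g ! k \<in> keys g" using k(1) by (metis length_var_list nth_mem set_var_list)
  then have "1 \<le> i" using assms(1) k(2) by (force simp: mons_def)
  then show "i \<in> {1..m}" using max_keys_sq_op(2)[OF assms(2) i] assms(3) by (simp add: sq_max_def)
qed

lemma sq_cell_iff_prefix:
  assumes g: "g \<noteq> 0" and F: "F \<subseteq> {1..m}"
  shows "F \<in> sq_cell m g \<longleftrightarrow> (\<exists>c. shift_list (var_list g) = take c (sorted_list_of_set F))"
proof -
  have "finite F" using F finite_subset by blast
  then show ?thesis
    using F max_keys_sq_op[OF g] strict_sorted_shift_list[of "var_list g"]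
    by (subst sorted_list_of_set_prefix_iff)
      (fastforce simp: sq_cell_def sq_max_def keys_sq_op[symmetric])+
qed

text \<open>The cells partition the supports of the monomials in L\<sigma>: covering is existence of
  a generator prefix, disjointness its uniqueness.\<close>

lemma sq_cells:
  assumes G: "lex_gens n G" and m: "\<forall>g\<in>G. sq_max g \<le> m"
  shows sq_cell_subset: "g \<in> G \<Longrightarrow> F \<in> sq_cell m g \<Longrightarrow> F \<subseteq> {1..m}"
    and sq_cell_cover: "F \<subseteq> {1..m} \<Longrightarrow> g \<in> G \<Longrightarrow> keys (sq_op g) \<subseteq> F \<Longrightarrow> \<exists>h\<in>G. F \<in> sq_cell m h"
    and sq_cell_disjoint: "g \<in> G \<Longrightarrow> h \<in> G \<Longrightarrow> F \<in> sq_cell m g \<Longrightarrow> F \<in> sq_cell m h \<Longrightarrow> g = h"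
proof -
  have nz: "g \<noteq> 0" "g \<in> mons {1..n}" if "g \<in> G" for g using G that by (auto simp: lex_gens_def)
  show sub: "F \<subseteq> {1..m}" if "g \<in> G" "F \<in> sq_cell m g" for g F
  proof -
    have "keys (sq_op g) \<union> {sq_max g<..m} \<subseteq> {1..m}"
      using keys_sq_op_subset[OF nz(2,1)[OF that(1)] bspec[OF m that(1)]] by auto
    then show ?thesis using that(2) unfolding sq_cell_def by blast
  qed
  show "\<exists>h\<in>G. F \<in> sq_cell m h" if F: "F \<subseteq> {1..m}" and g: "g \<in> G" "keys (sq_op g) \<subseteq> F"
  proof -
    have "finite F" "0 \<notin> F" using F finite_subset by auto
    then obtain h c where h: "h \<in> G" "shift_list (var_list h) = take c (sorted_list_of_set F)"
      using sq_op_prefix_exists[OF G _ _ g] by blast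
    then show ?thesis using sq_cell_iff_prefix[OF nz(1) F] by blast
  qed
  show "g = h" if g: "g \<in> G" and h: "h \<in> G" and F: "F \<in> sq_cell m g" "F \<in> sq_cell m h"
  proof -
    obtain b c where "shift_list (var_list g) = take b (sorted_list_of_set F)"
      "shift_list (var_list h) = take c (sorted_list_of_set F)"
      using F sq_cell_iff_prefix[OF nz(1)[OF g] sub[OF g F(1)]] sq_cell_iff_prefix[OF nz(1)[OF h] sub[OF g F(1)]] by blast
    then show ?thesis using sq_op_prefix_unique[OF G] g h by blast
  qed
qed

lemma sq_op_dvd_iff: "(\<exists>w. v = sq_op g + w) \<longleftrightarrow> keys (sq_op g) \<subseteq> keys v"
proof
  assume sub: "keys (sq_op g) \<subseteq> keys v"
  have "lookup (sq_op g) i \<le> lookup v i" for i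
  proof (cases "i \<in> keys (sq_op g)")
    case True
    then have "lookup v i \<noteq> 0" using sub by (metis in_keys_iff subsetD)
    then show ?thesis using True by (simp add: lookup_sq_op)
  qed (simp add: lookup_sq_op)
  then have "v = sq_op g + (v - sq_op g)"
    by (intro poly_mapping_eqI) (simp add: lookup_add lookup_minus)
  then show "\<exists>w. v = sq_op g + w" ..
qed (auto simp: keys_plus_nat)

text \<open>The variables of \<open>sq_op g\<close> may be repeated freely, so membership in the
  translate depends on the support alone.\<close>

lemma translate_sq_op_iff:
  "v \<in> (+) (sq_op g) ` mons (keys (sq_op g) \<union> {sq_max g<..m}) \<longleftrightarrow> keys v \<in> sq_cell m g"
proof
  assume v: "keys v \<in> sq_cell m g"
  then obtain w where "v = sq_op g + w" using sq_op_dvd_iff[of v g] by (auto simp: sq_cell_def)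
  then show "v \<in> (+) (sq_op g) ` mons (keys (sq_op g) \<union> {sq_max g<..m})"
    using v by (auto simp: sq_cell_def mons_def keys_plus_nat)
qed (auto simp: sq_cell_def mons_def keys_plus_nat)

lemma multiples_sq_op_iff:
  assumes G: "lex_gens n G" and m: "\<forall>g\<in>G. sq_max g \<le> m"
  shows "v \<in> multiples m (sq_op ` G) \<longleftrightarrow> (\<exists>g\<in>G. keys v \<in> sq_cell m g)"
proof
  assume "v \<in> multiples m (sq_op ` G)"
  then obtain g where "keys v \<subseteq> {1..m}" "g \<in> G" "\<exists>w. v = sq_op g + w"
    by (auto simp: multiples_def mons_def)
  then show "\<exists>g\<in>G. keys v \<in> sq_cell m g"
    using sq_cell_cover[OF G m] by (simp add: sq_op_dvd_iff)
next
  assume "\<exists>g\<in>G. keys v \<in> sq_cell m g"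
  then obtain g where g: "g \<in> G" "keys v \<in> sq_cell m g" by blast
  then have "keys v \<subseteq> {1..m}" using sq_cell_subset[OF G m] by blast
  moreover have "\<exists>w. v = sq_op g + w" using g(2) by (simp add: sq_op_dvd_iff sq_cell_def)
  ultimately show "v \<in> multiples m (sq_op ` G)" using g(1) by (auto simp: multiples_def mons_def)
qed

lemma sq_op_gens_subset_mons:
  assumes G: "lex_gens n G" and m: "\<forall>g\<in>G. sq_max g \<le> m"
  shows "sq_op ` G \<subseteq> mons {1..m}"
proof
  fix v assume "v \<in> sq_op ` G"
  then obtain g where g: "g \<in> G" "v = sq_op g" by auto
  then have "g \<in> mons {1..n}" "g \<noteq> 0" using G by (auto simp: lex_gens_def)
  then show "v \<in> mons {1..m}" using keys_sq_op_subset m g by (simp add: mons_def)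
qed

lemma keys_sq_op_Int: "g \<noteq> 0 \<Longrightarrow> keys (sq_op g) \<inter> {sq_max g<..m} = {}"
  using max_keys_sq_op(2)[of g] by (intro equals0I) (metis IntE greaterThanAtMost_iff not_le sq_max_def)

lemma card_keys_sq_op_Un: "g \<noteq> 0 \<Longrightarrow> card (keys (sq_op g) \<union> {sq_max g<..m}) = mdeg g + (m - sq_max g)"
  by (simp add: card_Un_disjoint keys_sq_op_Int)

lemma hilbert_series_sq_op:
  assumes G: "lex_gens n G" and m: "\<forall>g\<in>G. sq_max g \<le> m"
  shows "hilbert_series (mon_gen m (sq_op ` G) :: 'k::field mpol set)
    = (\<Sum>g\<in>G. fps_X ^ mdeg g * geom ^ (mdeg g + (m - sq_max g)))"
proof -
  have "hilbert_series (mon_gen m (sq_op ` G) :: 'k mpol set)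
      = (\<Sum>g\<in>G. fps_X ^ mdeg (sq_op g) * geom ^ card (keys (sq_op g) \<union> {sq_max g<..m}))"
  proof (rule hilbert_series_mon_gen)
    show "sq_op ` G \<subseteq> mons {1..m}" by (rule sq_op_gens_subset_mons[OF G m])
    show "finite G" using G by (simp add: lex_gens_def)
    show "multiples m (sq_op ` G) = (\<Union>g\<in>G. (+) (sq_op g) ` mons (keys (sq_op g) \<union> {sq_max g<..m}))"
      unfolding set_eq_iff UN_iff translate_sq_op_iff multiples_sq_op_iff[OF G m] by simp
    show "(+) (sq_op g) ` mons (keys (sq_op g) \<union> {sq_max g<..m}) \<inter>
        (+) (sq_op h) ` mons (keys (sq_op h) \<union> {sq_max h<..m}) = {}" if "g \<in> G" "h \<in> G" "g \<noteq> h" for g h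
      using sq_cell_disjoint[OF G m that(1,2)] that(3) by (auto simp only: disjoint_iff translate_sq_op_iff)
  qed simp
  also have "\<dots> = (\<Sum>g\<in>G. fps_X ^ mdeg g * geom ^ (mdeg g + (m - sq_max g)))"
  proof (intro sum.cong refl)
    fix g assume "g \<in> G"
    then have "g \<noteq> 0" using G by (auto simp: lex_gens_def)
    then show "fps_X ^ mdeg (sq_op g) * geom ^ card (keys (sq_op g) \<union> {sq_max g<..m})
        = fps_X ^ mdeg g * geom ^ (mdeg g + (m - sq_max g))" by (simp add: card_keys_sq_op_Un)
  qed
  finally show ?thesis .
qed

section \<open>Counting squarefree monomials\<close>

lemma mdeg_sqfree: "sqfree_mon v \<Longrightarrow> mdeg v = card (keys v)"
proof -
  assume v: "sqfree_mon v"
  have "lookup v i = 1" if "i \<in> keys v" for i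
    using v that unfolding sqfree_mon_def in_keys_iff by (metis le_antisym less_one not_le)
  then show ?thesis by (simp add: mdeg_def)
qed

lemma bij_betw_keys_sqfree: "bij_betw keys {v. sqfree_mon v} {F. finite F}"
  unfolding bij_betw_def
proof (intro conjI)
  show "inj_on keys {v. sqfree_mon v}"
  proof (rule inj_onI, rule poly_mapping_eqI)
    fix u v i assume "u \<in> {v. sqfree_mon v}" "v \<in> {v. sqfree_mon v}" "keys u = keys v"
    then have "lookup u i \<le> 1" "lookup v i \<le> 1" "i \<in> keys u \<longleftrightarrow> i \<in> keys v"
      by (simp_all add: sqfree_mon_def)
    moreover from this(3) have "lookup u i = 0 \<longleftrightarrow> lookup v i = 0"
      by (metis in_keys_iff)
    ultimately show "lookup u i = lookup v i" by linarith
  qed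
  show "keys ` {v. sqfree_mon v} = {F. finite F}"
  proof (intro equalityI subsetI)
    fix F :: "nat set" assume "F \<in> {F. finite F}"
    moreover have "sqfree_mon (mon_of (sorted_list_of_set F))"
      using distinct_sorted_list_of_set[of F]
      unfolding sqfree_mon_def lookup_mon_of distinct_count_atmost_1 by (metis order_refl zero_le_one)
    ultimately show "F \<in> keys ` {v. sqfree_mon v}"
      by (intro image_eqI[of _ _ "mon_of (sorted_list_of_set F)"]) auto
  qed auto
qed

text \<open>A member is the support of \<open>sq_op g\<close> together with an arbitrary subset of
  the later variables.\<close>

lemma card_sq_cell:
  assumes "g \<noteq> 0"
  shows "int (card {F \<in> sq_cell m g. card F = i}) = (fps_X ^ mdeg g * (1 + fps_X) ^ (m - sq_max g)) $ i"
proof -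
  define K where "K = keys (sq_op g)"
  have disj: "K \<inter> {sq_max g<..m} = {}"
    unfolding K_def using assms by (rule keys_sq_op_Int)
  have card_Un: "card (K \<union> W) = mdeg g + card W" if "W \<subseteq> {sq_max g<..m}" for W
    using that disj finite_subset[OF that] by (subst card_Un_disjoint) (auto simp: K_def)
  have eq: "{F \<in> sq_cell m g. card F = i} = (\<union>) K ` {W. W \<subseteq> {sq_max g<..m} \<and> mdeg g + card W = i}"
  proof (intro equalityI subsetI)
    fix F assume F: "F \<in> {F \<in> sq_cell m g. card F = i}"
    then have "F = K \<union> (F - K)" "F - K \<subseteq> {sq_max g<..m}" by (auto simp: sq_cell_def K_def)
    moreover from this have "mdeg g + card (F - K) = i" using F card_Un[of "F - K"] by simp
    ultimately show "F \<in> (\<union>) K ` {W. W \<subseteq> {sq_max g<..m} \<and> mdeg g + card W = i}" by blast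
  qed (use card_Un in \<open>auto simp: sq_cell_def K_def\<close>)
  have "inj_on ((\<union>) K) {W. W \<subseteq> {sq_max g<..m} \<and> mdeg g + card W = i}"
    using disj by (intro inj_onI) blast
  then have card: "card {F \<in> sq_cell m g. card F = i} = card {W. W \<subseteq> {sq_max g<..m} \<and> mdeg g + card W = i}"
    unfolding eq by (rule card_image)
  show ?thesis
  proof (cases "mdeg g \<le> i")
    case True
    then have "{W. W \<subseteq> {sq_max g<..m} \<and> mdeg g + card W = i} = {W. W \<subseteq> {sq_max g<..m} \<and> card W = i - mdeg g}"
      by auto
    then show ?thesis
      using True by (simp add: card n_subsets fps_X_power_mult_nth one_plus_X_power_nth)
  next
    case False
    then have "{W. W \<subseteq> {sq_max g<..m} \<and> mdeg g + card W = i} = {}" by auto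
    then show ?thesis using False by (simp add: card fps_X_power_mult_nth)
  qed
qed

text \<open>The cells of L\<sigma> decompose its squarefree monomials too; only the factor of each
  later variable changes, from 1/(1-t) to 1 + t, and that of each support variable from t/(1-t) to
  t.\<close>

lemma sqfree_count_sq_op:
  assumes G: "lex_gens n G" and m: "\<forall>g\<in>G. sq_max g \<le> m"
  shows "int (sqfree_count m (mon_gen m (sq_op ` G) :: 'k::field mpol set) i)
    = (\<Sum>g\<in>G. fps_X ^ mdeg g * (1 + fps_X) ^ (m - sq_max g)) $ i"
proof -
  let ?S = "{v \<in> mons {1..m}. sqfree_mon v \<and> mdeg v = i \<and> (mono_pol v :: 'k mpol) \<in> mon_gen m (sq_op ` G)}"
  have finG: "finite G" using G by (simp add: lex_gens_def)
  have fin_cell: "finite (sq_cell m g)" if "g \<in> G" for g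
    using sq_cell_subset[OF G m that] by (intro finite_subset[of "sq_cell m g" "Pow {1..m}"]) auto
  have S: "?S = {v. sqfree_mon v \<and> card (keys v) = i \<and> (\<exists>g\<in>G. keys v \<in> sq_cell m g)}"
    using sq_cell_subset[OF G m]
    by (auto simp: mono_pol_in_mon_gen_iff[OF sq_op_gens_subset_mons[OF G m]]
        multiples_sq_op_iff[OF G m] mdeg_sqfree mons_def)
  have img: "keys ` ?S = (\<Union>g\<in>G. {F \<in> sq_cell m g. card F = i})"
  proof (intro equalityI subsetI)
    fix F assume F: "F \<in> (\<Union>g\<in>G. {F \<in> sq_cell m g. card F = i})"
    then have "finite F" using sq_cell_subset[OF G m] finite_subset by blast
    then have "F \<in> keys ` {v. sqfree_mon v}"
      unfolding bij_betw_imp_surj_on[OF bij_betw_keys_sqfree] by simp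
    then obtain v where "sqfree_mon v" "keys v = F" by auto
    then show "F \<in> keys ` ?S" unfolding S using F by (intro image_eqI[of _ _ v]) auto
  qed (unfold S, auto)
  have "inj_on keys ?S"
    using bij_betw_imp_inj_on[OF bij_betw_keys_sqfree] by (rule inj_on_subset) auto
  then have "sqfree_count m (mon_gen m (sq_op ` G) :: 'k mpol set) i = card (keys ` ?S)"
    by (simp add: sqfree_count_def card_image)
  also have "\<dots> = (\<Sum>g\<in>G. card {F \<in> sq_cell m g. card F = i})"
    unfolding img
  proof (intro card_UN_disjoint ballI impI)
    show "{F \<in> sq_cell m g. card F = i} \<inter> {F \<in> sq_cell m h. card F = i} = {}" if "g \<in> G" "h \<in> G" "g \<noteq> h" for g h
      using sq_cell_disjoint[OF G m that(1,2)] that(3) by blast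
  qed (use finG fin_cell in auto)
  finally show ?thesis
    using G unfolding fps_sum_nth
    by (auto simp: lex_gens_def intro!: sum.cong card_sq_cell)
qed

subsection \<open>Hilbert depth of the lex ideal and termination of the procedure\<close>

text \<open>A generator divisible by another one could be dropped, contrary to minimality.\<close>

lemma lex_gens_if_lex_ideal:
  fixes L :: "'k::field mpol set"
  assumes L: "lex_ideal n L" and G: "min_mon_gens n L G" "finite G" and "0 \<notin> G"
  shows "lex_gens n G"
proof -
  have Gm: "G \<subseteq> mons {1..n}" and LG: "L = mon_gen n G" and min: "\<And>H. H \<subset> G \<Longrightarrow> L \<noteq> mon_gen n H"
    using G(1) by (auto simp: min_mon_gens_def)
  have mem: "mono_pol u \<in> L \<longleftrightarrow> u \<in> multiples n G" for u
    unfolding LG by (rule mono_pol_in_mon_gen_iff[OF Gm])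
  have "h = g" if gh: "g \<in> G" "h \<in> G" "h = g + w" for g h w
  proof (rule ccontr)
    assume "h \<noteq> g"
    have "u \<in> multiples n (G - {h})" if u: "u \<in> multiples n G" for u
    proof -
      obtain v x where v: "u \<in> mons {1..n}" "v \<in> G" "u = v + x" using u by (auto simp: multiples_def)
      show ?thesis
      proof (cases "v = h")
        case True
        then have "u = g + (w + x)" using v(3) gh(3) by (simp add: add.assoc)
        then show ?thesis using v(1) gh(1) \<open>h \<noteq> g\<close> by (auto simp: multiples_def)
      qed (use v in \<open>auto simp: multiples_def\<close>)
    qed
    moreover have "multiples n (G - {h}) \<subseteq> multiples n G" by (auto simp: multiples_def)
    ultimately have "multiples n (G - {h}) = multiples n G" by blast
    then have "(mon_gen n G :: 'k mpol set) = mon_gen n (G - {h})"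
      using Gm by (subst (1 2) mon_gen_eq) auto
    then show False using min[of "G - {h}"] gh(2) LG by blast
  qed
  moreover have "v \<in> multiples n G"
    if "u \<in> multiples n G" "v \<in> mons {1..n}" "mdeg v = mdeg u" "u < v" for u v
    using L that unfolding lex_ideal_def mem multiples_def[of n G] by blast
  ultimately show ?thesis using Gm assms unfolding lex_gens_def by blast
qed

lemma leads_nonempty: "V \<noteq> {0} \<Longrightarrow> 0 \<in> V \<Longrightarrow> leads V \<noteq> {}"
  by (auto simp: leads_def)

lemma hilbert_series_nonzero:
  assumes V: "graded_subspace n V" and ne: "V \<noteq> {0}"
  shows "hilbert_series V \<noteq> 0"
proof -
  have "0 \<in> V" using V by (simp add: graded_subspace_def mpol_vs.subspace_0)
  then obtain l where l: "l \<in> leads V" using leads_nonempty[OF ne] by blast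
  then have "hilbert_fun V (mdeg l) \<noteq> 0"
    using finite_leads_deg[OF V] by (auto simp: hilbert_fun_eq_card_leads[OF V])
  then have "hilbert_series V $ mdeg l \<noteq> 0" by (simp add: hilbert_series_def)
  then show ?thesis by auto
qed

text \<open>A nonzero element of degree 0 is a unit.\<close>

lemma hilbert_fun_0_proper:
  assumes I: "graded_ideal n (I :: 'k::field mpol set)" and proper: "I \<noteq> carrier (PR n)"
  shows "hilbert_fun I 0 = 0"
proof (rule ccontr)
  interpret ideal I "PR n" using I by (simp add: graded_ideal_def)
  have V: "graded_subspace n I" using I by (rule graded_subspace_if_graded_ideal)
  assume "hilbert_fun I 0 \<noteq> 0"
  then have "leads {f \<in> I. homog 0 f} \<noteq> {}"
    unfolding hilbert_fun_eq_card_leads[OF V] leads_homog[OF V] by (auto simp: card_eq_0_iff)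
  then obtain f where f: "f \<in> I" "homog 0 f" "f \<noteq> 0" by (auto simp: leads_def)
  define c where "c = lookup f 0"
  have u0: "u = 0" if "u \<in> keys f" for u using f(2) that by (simp add: homog_def mdeg_eq_0_iff)
  have f_eq: "f = single 0 c"
    using u0 by (intro poly_mapping_eqI) (auto simp: c_def lookup_single when_def in_keys_iff)
  then have "c \<noteq> 0" using f(3) by auto
  have "single 0 (1 / c) * f \<in> I"
    using I_l_closed[OF f(1), of "single 0 (1 / c)"] by (simp add: polys_def mons_def)
  then have "1 \<in> I" using \<open>c \<noteq> 0\<close> by (simp add: f_eq mult_single)
  then show False using one_imp_carrier proper by simp
qed

lemma rational_hilbert_series:
  fixes G :: "mon set"
  assumes "\<And>g. g \<in> G \<Longrightarrow> e g \<le> n"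
  shows "\<exists>q. (1 - fps_X) ^ n * (\<Sum>g\<in>G. fps_X ^ f g * geom ^ e g) = fps_of_poly q"
proof -
  have X: "fps_of_poly [:1, -1:] = (1 - fps_X :: int fps)"
    by (rule fps_ext) (auto simp: coeff_pCons fps_X_def split: nat.splits)
  have "(1 - fps_X) ^ n * (\<Sum>g\<in>G. fps_X ^ f g * geom ^ e g) = (\<Sum>g\<in>G. fps_X ^ f g * (1 - fps_X) ^ (n - e g))"
    unfolding sum_distrib_left
  proof (intro sum.cong refl)
    fix g assume "g \<in> G"
    then have "(1 - fps_X) ^ n = (1 - fps_X) ^ (n - e g) * (1 - fps_X :: int fps) ^ e g"
      using assms by (simp flip: power_add)
    then have "(1 - fps_X) ^ n * (fps_X ^ f g * geom ^ e g)
        = fps_X ^ f g * (1 - fps_X) ^ (n - e g) * ((1 - fps_X) ^ e g * geom ^ e g)"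
      by (simp add: mult_ac)
    then show "(1 - fps_X) ^ n * (fps_X ^ f g * geom ^ e g) = fps_X ^ f g * (1 - fps_X) ^ (n - e g)"
      by (simp add: one_minus_X_power_geom)
  qed
  also have "\<dots> = fps_of_poly (\<Sum>g\<in>G. monom 1 (f g) * [:1, -1:] ^ (n - e g))"
    by (simp add: fps_of_poly_sum fps_of_poly_mult fps_of_poly_monom' fps_of_poly_power X)
  finally show ?thesis by blast
qed

text \<open>If r is admissible for \<open>H\<close> then r + m - n is admissible for
  \<open>H'\<close>, and r \<le> n turns into the bound m. When r + m < n the claim is trivial.
  Applied in both directions it gives equality.\<close>

lemma Max_exponent_shift:
  assumes H: "nonneg_fps H" and eq: "geom ^ m * H = geom ^ n * H'"
    and R: "R = {r. r \<le> n \<and> nonneg_fps ((1 - fps_X) ^ r * H)}"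
    and R': "R' = {r. r \<le> m \<and> nonneg_fps ((1 - fps_X) ^ r * H')}"
  shows "Max R + m \<le> Max R' + n"
proof (cases "n \<le> Max R + m")
  case True
  have "finite R" "0 \<in> R" using H by (auto simp: R)
  then have "Max R \<in> R" by (intro Max_in) auto
  then have max: "Max R \<le> n" "nonneg_fps ((1 - fps_X) ^ Max R * H)" by (auto simp: R)
  define r where "r = Max R + m - n"
  have shift: "r + n = Max R + m" using True by (simp add: r_def)
  have "(1 - fps_X) ^ Max R * H = (1 - fps_X) ^ Max R * H * ((1 - fps_X) ^ m * geom ^ m)"
    by (simp add: one_minus_X_power_geom)
  also have "\<dots> = (1 - fps_X) ^ (Max R + m) * (geom ^ m * H)"
    by (simp add: power_add mult_ac)
  also have "\<dots> = (1 - fps_X) ^ r * H' * ((1 - fps_X) ^ n * geom ^ n)"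
    unfolding eq shift[symmetric] by (simp add: power_add mult_ac)
  finally have "nonneg_fps ((1 - fps_X) ^ r * H')" using max(2) by (simp add: one_minus_X_power_geom)
  then have "r \<in> R'" using max(1) by (auto simp: R' r_def)
  moreover have "finite R'" by (auto simp: R')
  ultimately have "r \<le> Max R'" by (intro Max_ge)
  then show ?thesis using shift by linarith
qed simp

text \<open>\<open>P 0\<close> stops the descent before truncated subtraction holds the counter at
  0; every index between the result and k has been rejected.\<close>

lemma while_option_decrement:
  fixes P :: "nat \<Rightarrow> bool"
  assumes "P 0"
  shows "\<exists>j\<le>k. while_option (\<lambda>j. \<not> P j) (\<lambda>j. j - 1) k = Some j \<and> P j \<and> (\<forall>i. j < i \<and> i \<le> k \<longrightarrow> \<not> P i)"
proof (induction k)
  case 0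
  then show ?case using assms by (subst while_option_unfold) auto
next
  case (Suc k)
  show ?case
  proof (cases "P (Suc k)")
    case True
    then show ?thesis by (subst while_option_unfold) auto
  next
    case False
    then have "while_option (\<lambda>j. \<not> P j) (\<lambda>j. j - 1) (Suc k) = while_option (\<lambda>j. \<not> P j) (\<lambda>j. j - 1) k"
      by (subst while_option_unfold) simp
    then show ?thesis using Suc False by (metis le_Suc_eq)
  qed
qed

text \<open>The starting value excludes no candidate: an admissible d + i above the result has
  b_(d+1) nonnegative, hence i \<le> \<open>j0\<close>, so i was tried and rejected.\<close>

lemma hdepth_procedure_eq_Max:
  assumes H: "H = (\<Sum>k=d..m. fps_const (int (a k)) * (fps_X ^ k * geom ^ k))"
    and d: "d \<le> m" "a d > 0"
  shows "hdepth_procedure a d m = Some (Max {r. r \<le> m \<and> nonneg_fps ((1 - fps_X) ^ r * H)})" (is "_ = Some (Max ?R)")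
proof -
  define P where "P j \<longleftrightarrow> (\<forall>i\<in>{d..d + j}. b_coeff a d (d + j) i \<ge> 0)" for j
  define j0 where "j0 = min (a (d + 1) div a d) (m - d)"
  have P_iff: "P j \<longleftrightarrow> nonneg_fps ((1 - fps_X) ^ (d + j) * H)" if "d + j \<le> m" for j
    unfolding P_def using nonneg_iff_b_coeff_nonneg[OF _ that H] by simp
  have "P 0" by (simp add: P_def b_coeff_first)
  then obtain j where j: "j \<le> j0" "while_option (\<lambda>j. \<not> P j) (\<lambda>j. j - 1) j0 = Some j" "P j"
    "\<And>i. j < i \<Longrightarrow> i \<le> j0 \<Longrightarrow> \<not> P i"
    using while_option_decrement[of P j0] by blast
  have jm: "d + j \<le> m" using j(1) d(1) unfolding j0_def by linarith
  have "r \<le> d + j" if r: "r \<in> ?R" for r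
  proof (rule ccontr)
    assume "\<not> r \<le> d + j"
    define i where "i = r - d"
    have i: "r = d + i" "j < i" "d + i \<le> m" using \<open>\<not> r \<le> d + j\<close> r by (auto simp: i_def)
    then have "P i" using r P_iff by auto
    then have "b_coeff a d (d + i) (Suc d) \<ge> 0" using i(2) by (simp add: P_def)
    then have "int (i * a d) \<le> int (a (Suc d))" using i(2) by (simp add: b_coeff_second)
    then have "i * a d \<le> a (d + 1)" by (metis Suc_eq_plus1 of_nat_le_iff)
    then have "i \<le> a (d + 1) div a d" using d(2) by (simp add: less_eq_div_iff_mult_less_eq)
    then have "i \<le> j0" using i(3) by (simp add: j0_def)
    then show False using j(4)[OF i(2)] \<open>P i\<close> by blast
  qed
  moreover have "d + j \<in> ?R" using jm j(3) P_iff by auto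
  moreover have "finite ?R" by simp
  ultimately have "Max ?R = d + j" by (intro Max_eqI)
  then show ?thesis using j(2) by (simp add: hdepth_procedure_def P_def[abs_def] j0_def)
qed

theorem mainTheorem4:
  fixes I L L\<sigma> :: "'k::field mpol set"
    and u :: "nat \<Rightarrow> mon"
    and n m s d :: nat
    and a :: "nat \<Rightarrow> nat"
  assumes I: "graded_ideal n I" "I \<noteq> {0}" "I \<noteq> carrier (PR n)"
    and L: "lex_ideal n L" "\<forall>k. hilbert_fun L k = hilbert_fun (lex_initial_ideal n I) k"
    and gens: "inj_on u {1..s}" "min_mon_gens n L (u ` {1..s})"
    and m: "m = Max {max_var (u i) + mdeg (u i) - 1 | i. i \<in> {1..s}}"
    and L\<sigma>: "L\<sigma> = mon_gen m {sq_op (u i) | i. i \<in> {1..s}}"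
    and d: "d = Min {mdeg (sq_op (u i)) | i. i \<in> {1..s}}"
    and a: "a = (\<lambda>i. if i \<le> m then sqfree_count m L\<sigma> i else 0)"
  shows "(\<exists>h. hdepth_procedure a d m = Some h \<and> h = hdepth m L\<sigma>)
    \<and> hdepth n I = hdepth n L
    \<and> int (hdepth n L) = int (hdepth m L\<sigma>) - (int m - int n)"
proof -
  define G where "G = u ` {1..s}"
  have finG: "finite G" by (simp add: G_def)
  have m_G: "m = Max (sq_max ` G)"
    unfolding m G_def sq_max_def by (rule arg_cong[where f = Max]) auto
  have L\<sigma>_G: "L\<sigma> = mon_gen m (sq_op ` G)"
    unfolding L\<sigma> G_def by (rule arg_cong[where f = "mon_gen m"]) auto
  have d_G: "d = Min (mdeg ` G)"
    unfolding d G_def mdeg_sq_op by (rule arg_cong[where f = Min]) auto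
  have min: "min_mon_gens n L G" using gens(2) by (simp add: G_def)
  then have Gm: "G \<subseteq> mons {1..n}" and LG: "L = mon_gen n G" by (auto simp: min_mon_gens_def)
  have subI: "graded_subspace n I" using I(1) by (rule graded_subspace_if_graded_ideal)
  have subL: "graded_subspace n L" unfolding LG using Gm by (rule graded_subspace_mon_gen)
  have fun_eq: "hilbert_fun L k = hilbert_fun I k" for k
    using L(2) hilbert_fun_lex_initial_ideal[OF I(1)] by simp
  then have series_eq: "hilbert_series L = hilbert_series I" by (simp add: hilbert_series_def)
  have ne: "hilbert_series I \<noteq> 0" using hilbert_series_nonzero[OF subI I(2)] .
  \<comment> \<open>Exponent 0 is the monomial 1; it would give \<open>L\<close>, and so
    \<open>I\<close>, a nonzero degree 0 part.\<close>
  have "0 \<notin> G"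
  proof
    assume "0 \<in> G"
    then have "0 \<in> leads L" using multiples_refl[OF _ Gm] by (simp add: LG leads_mon_gen[OF Gm])
    then have "hilbert_fun L 0 \<noteq> 0"
      using finite_leads_deg[OF subL, of 0] by (auto simp: hilbert_fun_eq_card_leads[OF subL])
    then show False using fun_eq hilbert_fun_0_proper[OF I(1,3)] by simp
  qed
  with L(1) min finG have G: "lex_gens n G" by (rule lex_gens_if_lex_ideal)
  have le_m: "\<forall>g\<in>G. sq_max g \<le> m" using finG by (simp add: m_G)
  note series_L = hilbert_series_lex[OF G, where ?'k = 'k, folded LG]
  note series_L\<sigma> = hilbert_series_sq_op[OF G le_m, where ?'k = 'k, folded L\<sigma>_G]
  have "G \<noteq> {}" using ne series_eq series_L by auto
  have g: "1 \<le> max_var g" "max_var g \<le> n" "1 \<le> mdeg g" "sq_max g \<le> m" "mdeg g \<le> sq_max g" if "g \<in> G" for g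
  proof -
    have "g \<noteq> 0" using that \<open>0 \<notin> G\<close> by auto
    then show mv: "1 \<le> max_var g" "max_var g \<le> n"
      using max_var_in_keys[of g] subsetD[OF Gm that] by (auto simp: mons_def)
    show "1 \<le> mdeg g" using \<open>g \<noteq> 0\<close> by (simp add: Suc_le_eq mdeg_eq_0_iff zero_less_iff_neq_zero)
    show "sq_max g \<le> m" using le_m that by blast
    show "mdeg g \<le> sq_max g" using mv(1) by (simp add: sq_max_def)
  qed
  have subL\<sigma>: "graded_subspace m L\<sigma>"
    unfolding L\<sigma>_G by (rule graded_subspace_mon_gen[OF sq_op_gens_subset_mons[OF G le_m]])

  let ?R = "{r. r \<le> n \<and> nonneg_fps ((1 - fps_X) ^ r * hilbert_series L)}"
  let ?R\<sigma> = "{r. r \<le> m \<and> nonneg_fps ((1 - fps_X) ^ r * hilbert_series L\<sigma>)}"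
  obtain q where q: "(1 - fps_X) ^ n * hilbert_series L = fps_of_poly q"
    unfolding series_L using rational_hilbert_series[of G "\<lambda>g. Suc n - max_var g" n mdeg] g(1) by force
  obtain q\<sigma> where q\<sigma>: "(1 - fps_X) ^ m * hilbert_series L\<sigma> = fps_of_poly q\<sigma>"
    unfolding series_L\<sigma> using rational_hilbert_series[of G "\<lambda>g. mdeg g + (m - sq_max g)" m mdeg] g(4,5) by force
  \<comment> \<open>Termwise: the numbers of free variables n + 1 - m(h) and m + 1 - m(h) differ by
    m - n for every h.\<close>
  have shift: "geom ^ m * hilbert_series L = geom ^ n * hilbert_series L\<sigma>"
    unfolding series_L series_L\<sigma> sum_distrib_left
  proof (intro sum.cong refl)
    fix h assume h: "h \<in> G"
    have "m + (Suc n - max_var h) = n + (mdeg h + (m - sq_max h))"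
      using g[OF h] by (simp add: sq_max_def)
    then have "geom ^ m * geom ^ (Suc n - max_var h) = geom ^ n * geom ^ (mdeg h + (m - sq_max h))"
      by (simp flip: power_add)
    then show "geom ^ m * (fps_X ^ mdeg h * geom ^ (Suc n - max_var h))
        = geom ^ n * (fps_X ^ mdeg h * geom ^ (mdeg h + (m - sq_max h)))"
      by (simp add: mult_ac)
  qed
  have ne\<sigma>: "hilbert_series L\<sigma> \<noteq> 0"
  proof
    assume "hilbert_series L\<sigma> = 0"
    then have "(1 - fps_X) ^ m * geom ^ m * hilbert_series L = 0" using shift by (simp add: mult.assoc)
    then show False using ne series_eq by (simp add: one_minus_X_power_geom)
  qed
  have hL: "hdepth n L = Max ?R" using ne series_eq by (intro hdepth_eq_Max[OF subL _ q]) simp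
  have hI: "hdepth n I = Max ?R" using ne q unfolding series_eq by (rule hdepth_eq_Max[OF subI])
  have hL\<sigma>: "hdepth m L\<sigma> = Max ?R\<sigma>" by (rule hdepth_eq_Max[OF subL\<sigma> ne\<sigma> q\<sigma>])
  have "Max ?R + m = Max ?R\<sigma> + n"
    using Max_exponent_shift[OF nonneg_fps_hilbert_series shift refl refl]
      Max_exponent_shift[OF nonneg_fps_hilbert_series shift[symmetric] refl refl] by (rule order_antisym)

  have "Min (mdeg ` G) \<in> mdeg ` G" using finG \<open>G \<noteq> {}\<close> by (intro Min_in) auto
  then obtain g0 where g0: "g0 \<in> G" "mdeg g0 = d" by (auto simp: d_G)
  have d_le: "d \<le> mdeg h" if "h \<in> G" for h using that finG by (simp add: d_G)
  define A :: "int fps" where "A = (\<Sum>h\<in>G. fps_X ^ mdeg h * (1 + fps_X) ^ (m - sq_max h))"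
  have count: "int (sqfree_count m L\<sigma> k) = A $ k" for k
    unfolding A_def L\<sigma>_G by (rule sqfree_count_sq_op[OF G le_m])
  have A_nth: "A $ k = (\<Sum>h\<in>G. if mdeg h \<le> k then int (m - sq_max h choose (k - mdeg h)) else 0)" for k
    by (simp add: A_def fps_sum_nth fps_X_power_mult_nth one_plus_X_power_nth not_less if_distrib cong: if_cong)
      (intro sum.cong, auto)
  have A: "A = (\<Sum>k=d..m. fps_const (int (a k)) * fps_X ^ k)"
  proof (rule fps_ext)
    fix k
    \<comment> \<open>No generator has degree below d, and a set in the cell of h has at most deg h
      + m - \<open>sq_max h\<close> elements, which is at most m.\<close>
    have "A $ k = 0" if "k \<notin> {d..m}"
      unfolding A_nth
    proof (intro sum.neutral ballI)
      fix h assume h: "h \<in> G"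
      then show "(if mdeg h \<le> k then int (m - sq_max h choose (k - mdeg h)) else 0) = 0"
        using that d_le[OF h] g(3-5)[OF h] by (auto simp: binomial_eq_0_iff)
    qed
    then show "A $ k = (\<Sum>k=d..m. fps_const (int (a k)) * fps_X ^ k) $ k"
      by (auto simp: fps_sum_nth a count if_distrib cong: if_cong)
  qed
  have "(\<Sum>k=d..m. fps_const (int (a k)) * (fps_X ^ k * geom ^ k)) = A oo (fps_X * geom)"
    unfolding A by (simp add: fps_compose_sum_distrib fps_monom_compose_geom)
  also have "\<dots> = hilbert_series L\<sigma>"
    unfolding A_def series_L\<sigma>
    by (simp add: fps_compose_sum_distrib fps_compose_mult_distrib one_plus_X_compose_geom
        power_mult_distrib power_add mult.assoc flip: fps_compose_power)
  finally have series: "hilbert_series L\<sigma> = (\<Sum>k=d..m. fps_const (int (a k)) * (fps_X ^ k * geom ^ k))" ..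
  have dm: "d \<le> m" using g(4,5)[OF g0(1)] g0(2) by linarith
  \<comment> \<open>A generator of least degree contributes a binomial coefficient with lower entry
    0, that is 1.\<close>
  have "1 \<le> A $ d"
    unfolding A_nth using member_le_sum[of g0 G "\<lambda>h. if mdeg h \<le> d then int (m - sq_max h choose (d - mdeg h)) else 0"]
      g0 finG by simp
  then have "a d > 0" using dm count[of d] by (simp add: a)
  with hdepth_procedure_eq_Max[OF series dm] have "hdepth_procedure a d m = Some (hdepth m L\<sigma>)"
    by (simp add: hL\<sigma>)
  moreover have "int (Max ?R) = int (Max ?R\<sigma>) - (int m - int n)"
    using \<open>Max ?R + m = Max ?R\<sigma> + n\<close> by linarith
  ultimately show ?thesis unfolding hI hL hL\<sigma> by blast
qed

end
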